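(* Let $\alpha\in\mathbb{N}_0+\frac12$ and $\mathbf m=(m_1,\dots,m_n)\in\mathbb{N}_0^n$ with $m_1,\dots,m_n$ pairwise distinct, and $(t_{m_1},\dots,t_{m_n})\in\mathbb{R}^n$. Then $\tau^{(\alpha)}_{\mathbf m}(z)$ has no zeros on $[-1,1]$ if and only if $t_{m_j}>-(\nu^{(\alpha)}_{m_j})^{-1}$ for all $j=1,\dots,n$. If these conditions hold, then $\{C^{(\alpha)}_{\mathbf m;i}\}_{i\in\mathbb{N}_0}$ is a family of exceptional Gegenbauer polynomials with weight $W^{(\alpha)}_{\tau^{(\alpha)}_{\mathbf m}}(z)=(1-z^2)^{\alpha-1/2}\tau^{(\alpha)}_{\mathbf m}(z)^{-2}$, and $$\int_{-1}^1\left(C^{(\alpha)}_{\mathbf m;i}(u)\right)^2W^{(\alpha)}_{\tau^{(\alpha)}_{\mathbf m}}(u)\,du=\frac{\nu^{(\alpha)}_i}{1+\delta_{i,\mathbf m}t_i\nu^{(\alpha)}_i},\qquad i\in\mathbb{N}_0,$$ where $\delta_{i,\mathbf m}=1$ if $i\in\{m_1,\dots,m_n\}$ and $0$ otherwise.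
   Context: $\nu^{(\alpha)}_i=\dfrac{\pi\,2^{1-2\alpha}\Gamma(i+2\alpha)}{i!\,(i+\alpha)\Gamma(\alpha)^2}$. For a nonzero polynomial $\tau$, $T^{(\alpha)}_\tau=(1-z^2)\left(D_z^2-2\frac{\tau_z}{\tau}D_z+\frac{\tau_{zz}}{\tau}\right)-(2\alpha+1)zD_z+(2\alpha-1)z\frac{\tau_z}{\tau}$ and $W^{(\alpha)}_\tau=(1-z^2)^{\alpha-1/2}\tau^{-2}$. $T^{(\alpha)}_\tau$ is an exceptional Gegenbauer operator if it has polynomial eigenfunctions $\{\pi_i\}_{i\in\mathbb{N}_0}$ of pairwise distinct degrees with only finitely many nonnegative integers missing from $\{\deg\pi_i\}$. $\{\pi_i\}$ is a family of exceptional Gegenbauer polynomials with weight $W^{(\alpha)}_\tau$ if (a) $\tau$ has no zeros on $I=[-1,1]$; (b) the $\pi_i$ are the eigenpolynomials of an exceptional Gegenbauer operator $T^{(\alpha)}_\tau$; (c) $\{\pi_i\}$ is complete in $L^2(I,W^{(\alpha)}_\tau(z)dz)$. $C^{(\alpha)}_i(z)=\sum_{k=0}^{\lfloor i/2\rfloor}(-1)^k\frac{\Gamma(i-k+\alpha)}{\Gamma(\alpha)k!(i-2k)!}(2z)^{i-2k}$; $W^{(\alpha)}(z)=(1-z^2)^{\alpha-1/2}$; $\rho^{(\alpha)}_{ij}(z)=\int_{-1}^zC^{(\alpha)}_iC^{(\alpha)}_jW^{(\alpha)}\,du$. $\mathcal R^{(\alpha)}_{\mathbf m}$ is the $n\times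 n$ matrix with entries $\delta_{k\ell}+t_{m_\ell}\rho^{(\alpha)}_{m_km_\ell}(z)$; $\tau^{(\alpha)}_{\mathbf m}=\det\mathcal R^{(\alpha)}_{\mathbf m}$; $\mathbf Q^{(\alpha)}_{\mathbf m}=\tau^{(\alpha)}_{\mathbf m}(\mathcal R^{(\alpha)}_{\mathbf m})^{-1}(C^{(\alpha)}_{m_1},\dots,C^{(\alpha)}_{m_n})^T$. $C^{(\alpha)}_{\mathbf m;i}$ is the $(n+1)$-st entry of $\mathbf Q^{(\alpha)}_{(m_1,\dots,m_n,i)}$ computed with parameters $(t_{m_1},\dots,t_{m_n},s)$, $s\in\mathbb{R}$ arbitrary (the entry does not depend on $s$). *)

theory Defs
  imports "HOL-Analysis.Analysis" "HOL-Computational_Algebra.Polynomial"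
          "Jordan_Normal_Form.Determinant"
begin

definition alph :: "nat \<Rightarrow> real" where
  "alph k = real k + 1/2"

definition geg_nu :: "real \<Rightarrow> nat \<Rightarrow> real" where
  "geg_nu a i = pi * 2 powr (1 - 2*a) * Gamma (real i + 2*a)
      / (fact i * (real i + a) * (Gamma a)^2)"

definition gegC :: "real \<Rightarrow> nat \<Rightarrow> real \<Rightarrow> real" where
  "gegC a i z = (\<Sum>k = 0..i div 2. (-1)^k * Gamma (real (i - k) + a)
      / (Gamma a * fact k * fact (i - 2*k)) * (2*z)^(i - 2*k))"

text \<open>Gegenbauer weight W^(alpha)(z) = (1-z^2)^(alpha-1/2) for alpha = k + 1/2,
  i.e. (1-z^2)^k (a polynomial, so that rho and tau are polynomials on all of R).\<close>
definition gegW :: "nat \<Rightarrow> real \<Rightarrow> real" where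
  "gegW k z = (1 - z^2)^k"

definition geg_rho :: "nat \<Rightarrow> nat \<Rightarrow> nat \<Rightarrow> real \<Rightarrow> real" where
  "geg_rho k i j z = interval_lebesgue_integral lborel (ereal (-1)) (ereal z)
      (\<lambda>u. gegC (alph k) i u * gegC (alph k) j u * gegW k u)"

definition Rmat :: "nat \<Rightarrow> nat list \<Rightarrow> real list \<Rightarrow> real \<Rightarrow> real mat" where
  "Rmat k m ts z = Matrix.mat (length m) (length m)
      (\<lambda>(a, b). (if a = b then 1 else 0) + ts ! b * geg_rho k (m ! a) (m ! b) z)"

definition tau_m :: "nat \<Rightarrow> nat list \<Rightarrow> real list \<Rightarrow> real \<Rightarrow> real" where
  "tau_m k m ts z = Determinant.det (Rmat k m ts z)"

text \<open>Q_m = tau_m R_m^{-1} (C_{m_1},...,C_{m_n})^T = adj(R_m) (C_{m_1},...,C_{m_n})^T\<close>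
definition Qvec :: "nat \<Rightarrow> nat list \<Rightarrow> real list \<Rightarrow> real \<Rightarrow> real vec" where
  "Qvec k m ts z = adj_mat (Rmat k m ts z) *\<^sub>v
      Matrix.vec (length m) (\<lambda>a. gegC (alph k) (m ! a) z)"

text \<open>C_{m;i}: the (n+1)-st entry of Q_{(m,i)} with parameters (ts, s); we take s = 0.\<close>
definition gegCm :: "nat \<Rightarrow> nat list \<Rightarrow> real list \<Rightarrow> nat \<Rightarrow> real \<Rightarrow> real" where
  "gegCm k m ts i z = vec_index (Qvec k (m @ [i]) (ts @ [0]) z) (length m)"

definition T_op :: "real \<Rightarrow> real poly \<Rightarrow> real poly \<Rightarrow> real \<Rightarrow> real" where
  "T_op a \<tau> p z =
     (1 - z^2) * (poly (pderiv (pderiv p)) z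
                  - 2 * (poly (pderiv \<tau>) z / poly \<tau> z) * poly (pderiv p) z
                  + (poly (pderiv (pderiv \<tau>)) z / poly \<tau> z) * poly p z)
     - (2*a + 1) * z * poly (pderiv p) z
     + (2*a - 1) * z * (poly (pderiv \<tau>) z / poly \<tau> z) * poly p z"

definition is_eigenpoly :: "real \<Rightarrow> real poly \<Rightarrow> real poly \<Rightarrow> bool" where
  "is_eigenpoly a \<tau> p \<longleftrightarrow> p \<noteq> 0 \<and>
     (\<exists>ev. \<forall>z. poly \<tau> z \<noteq> 0 \<longrightarrow> T_op a \<tau> p z = ev * poly p z)"

definition exc_geg_eigenfamily :: "real \<Rightarrow> real poly \<Rightarrow> (nat \<Rightarrow> real poly) \<Rightarrow> bool" where
  "exc_geg_eigenfamily a \<tau> pis \<longleftrightarrow> \<tau> \<noteq> 0 \<and>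
     (\<forall>i. is_eigenpoly a \<tau> (pis i)) \<and>
     inj (\<lambda>i. degree (pis i)) \<and>
     finite (UNIV - range (\<lambda>i. degree (pis i)))"

definition exc_geg_operator :: "real \<Rightarrow> real poly \<Rightarrow> bool" where
  "exc_geg_operator a \<tau> \<longleftrightarrow> (\<exists>pis. exc_geg_eigenfamily a \<tau> pis)"

definition W_tau :: "real \<Rightarrow> real poly \<Rightarrow> real \<Rightarrow> real" where
  "W_tau a \<tau> z = (1 - z^2) powr (a - 1/2) / (poly \<tau> z)^2"

definition in_L2W :: "(real \<Rightarrow> real) \<Rightarrow> (real \<Rightarrow> real) \<Rightarrow> bool" where
  "in_L2W W f \<longleftrightarrow> f \<in> borel_measurable lborel \<and>
     (\<integral>\<^sup>+ x \<in> {-1..1}. ennreal ((f x)^2 * W x) \<partial>lborel) < \<infinity>"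

definition complete_L2W :: "(real \<Rightarrow> real) \<Rightarrow> (nat \<Rightarrow> real poly) \<Rightarrow> bool" where
  "complete_L2W W pis \<longleftrightarrow> (\<forall>f. in_L2W W f \<longrightarrow> (\<forall>\<epsilon>>0. \<exists>N c.
      (\<integral>\<^sup>+ x \<in> {-1..1}. ennreal ((f x - (\<Sum>i<N. c i * poly (pis i) x))^2 * W x) \<partial>lborel)
        < ennreal \<epsilon>))"

definition exc_geg_family :: "real \<Rightarrow> real poly \<Rightarrow> (nat \<Rightarrow> real poly) \<Rightarrow> bool" where
  "exc_geg_family a \<tau> pis \<longleftrightarrow>
     (\<forall>z\<in>{-1..1}. poly \<tau> z \<noteq> 0) \<and>
     exc_geg_operator a \<tau> \<and> exc_geg_eigenfamily a \<tau> pis \<and>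
     complete_L2W (W_tau a \<tau>) pis"

end

theory Submission
  imports Defs
begin

text \<open>
  Write \<open>R = I + \<rho> T\<close> with \<open>T = diag t\<close>, let \<open>C i\<close> be the classical polynomials with eigenvalue
  \<open>- ev i\<close>, and put \<open>f i = C\<^bsub>m;i\<^esub> / \<tau>\<close>. Cramer's rule makes the \<open>f i\<close> the unique solution of
  \<open>f i + (\<Sum>b\<in>m. \<rho> i b * t b * f b) = C i\<close> wherever \<open>\<tau>\<close> does not vanish.
  Differentiating this system, and using \<open>\<rho>' i j = W * C i * C j\<close>, the Wronskian formula for
  \<open>(ev j - ev i) * \<rho> i j\<close> and Jacobi's formula \<open>\<tau>' / \<tau> = W * (\<Sum>b\<in>m. t b * C b * f b)\<close>, gives the
  eigenvalue equation for \<open>T\<^sub>\<tau>\<close> with the same eigenvalues \<open>- ev i\<close>. Solving the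
  system with right-hand side \<open>\<rho> i j\<close> instead gives a primitive of \<open>W * f i * f j\<close>, whose value at \<open>1\<close> is
  the norm; positivity of the norm forces the condition on \<open>t\<close>, and Bessel's inequality gives the converse.
  The degrees follow from the eigenvalues, and completeness holds because \<open>C i \<mapsto> f i\<close> extends to a
  Volterra operator with an explicit inverse.
\<close>

section \<open>The classical Gegenbauer polynomials\<close>

text \<open>Half-integral \<alpha> makes \<open>gegW\<close> a polynomial, and with it \<rho>,
  \<tau> and the numerators of the transformed functions. The obstacle is that \<tau> may vanish
  outside [-1,1]: identities for the quotients are proved pointwise on the open set where \<tau> is
  nonzero, and derivatives are compared there. Two facts carry most of the argument. The matrix
  \<rho> T need not be symmetric, yet I + \<rho> T is self-adjoint for the bilinear form \<Sum> t b
  x b y b, because \<rho> is symmetric; so the operator can be moved between factors, trading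
  \<open>f\<close> for \<open>C\<close>. And the solution is unique, so an identity between
  transformed functions need only be checked after applying the operator, where it is a statement
  about classical polynomials. Differentiating \<rho> yields only multiples of the vector of the
  \<open>C i\<close>, and the scalar coefficients of these corrections can all be expressed through
  \<tau>'/\<tau> and its derivative.\<close>

lemma Gamma_real_plus1: "x > 0 \<Longrightarrow> Gamma (x + 1) = x * Gamma (x::real)"
  by (rule Gamma_plus1) (auto simp: nonpos_Ints_def)

lemma Gamma_real_nonzero: "x > 0 \<Longrightarrow> Gamma (x::real) \<noteq> 0"
  using Gamma_real_pos[of x] by fastforce

definition geg_poly :: "real \<Rightarrow> nat \<Rightarrow> real poly" where
  "geg_poly a i = (\<Sum>k = 0..i div 2. monom ((-1)^k * Gamma (real (i - k) + a)
      / (Gamma a * fact k * fact (i - 2*k)) * 2 ^ (i - 2*k)) (i - 2*k))"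

lemma poly_geg_poly [simp]: "poly (geg_poly a i) z = gegC a i z"
  by (simp add: geg_poly_def gegC_def poly_sum poly_monom power_mult_distrib mult.assoc)

lemma coeff_geg_poly:
  "coeff (geg_poly a i) l = (if l \<le> i \<and> even (i - l)
     then (-1)^((i - l) div 2) * Gamma (real ((i + l) div 2) + a) * 2 ^ l
      / (Gamma a * fact ((i - l) div 2) * fact l) else 0)"
proof (cases "l \<le> i \<and> even (i - l)")
  case True
  then obtain j where j: "i - l = 2 * j" by (blast elim: evenE)
  have i: "i = l + 2 * j" using j True by auto
  have "coeff (geg_poly a i) l = (\<Sum>k = 0..i div 2. if k = j then (-1)^k * Gamma (real (i - k) + a)
      / (Gamma a * fact k * fact (i - 2*k)) * 2 ^ (i - 2*k) else 0)"
    unfolding geg_poly_def coeff_sum by (rule sum.cong) (auto simp: i)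
  also have "\<dots> = (-1)^j * Gamma (real (i - j) + a) / (Gamma a * fact j * fact (i - 2*j)) * 2 ^ (i - 2*j)"
    by (subst sum.delta) (auto simp: i)
  also have "\<dots> = (-1)^((i - l) div 2) * Gamma (real ((i + l) div 2) + a) * 2 ^ l
      / (Gamma a * fact ((i - l) div 2) * fact l)"
    by (simp add: i add.commute)
  finally show ?thesis unfolding if_P[OF True] .
next
  case False
  have "coeff (geg_poly a i) l = 0"
    unfolding geg_poly_def coeff_sum
    by (rule sum.neutral) (use False in auto)
  with False show ?thesis by auto
qed

lemma degree_geg_poly_le: "degree (geg_poly a i) \<le> i"
  by (rule degree_le) (auto simp: coeff_geg_poly)

lemma coeff_geg_poly_top_nonzero:
  assumes "a > 0"
  shows "coeff (geg_poly a i) i \<noteq> 0"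
proof -
  have "Gamma (real i + a) > 0" "Gamma a > 0" using assms by (auto intro!: Gamma_real_pos)
  then show ?thesis by (simp add: coeff_geg_poly)
qed

text \<open>Writing the index as \<open>l + 2 * j\<close> removes the parity test and the integer
  divisions, so coefficient recurrences become identities in \<open>j\<close>.\<close>

lemma coeff_geg_poly_even:
  "coeff (geg_poly a (l + 2 * j)) l
     = (-1)^j * Gamma (real (l + j) + a) * 2 ^ l / (Gamma a * fact j * fact l)"
proof -
  have "(l + 2 * j - l) div 2 = j" "(l + 2 * j + l) div 2 = l + j" by auto
  then show ?thesis unfolding coeff_geg_poly by simp
qed

text \<open>In each coefficient the three Gamma arguments differ by at most one. The relation is
  what links the norms of consecutive polynomials.\<close>

lemma geg_poly_three_term:
  assumes a: "a > 0"
  shows "Polynomial.smult (real n + 2) (geg_poly a (Suc (Suc n)))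
         + Polynomial.smult (real n + 2 * a) (geg_poly a n)
       = Polynomial.smult (2 * (real n + 1 + a)) (pCons 0 (geg_poly a (Suc n)))" (is "?L = ?R")
proof (rule poly_eqI)
  fix l
  have Ga: "Gamma a \<noteq> 0" by (rule Gamma_real_nonzero[OF a])
  show "coeff ?L l = coeff ?R l"
  proof (cases "l \<le> n + 2 \<and> even (n + 2 - l)")
    case False
    moreover from this have "\<not> (l \<le> n \<and> even (n - l))" by auto
    moreover from False have "\<not> (l' \<le> Suc n \<and> even (Suc n - l'))" if "l = Suc l'" for l'
      using that by auto
    ultimately show ?thesis
      by (cases l) (auto simp: coeff_geg_poly coeff_pCons simp del: even_Suc)
  next
    case True
    then obtain j where "n + 2 - l = 2 * j" by (blast elim: evenE)
    then have n2: "n + 2 = l + 2 * j" using True by auto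
    have r: "coeff (pCons 0 (geg_poly a (Suc n))) l
        = (-1)^j * Gamma (real l + real j - 1 + a) * (real l * 2^l) / (2 * Gamma a * fact j * fact l)"
    proof (cases l)
      case (Suc l')
      then have "Suc n = l' + 2 * j" using n2 by simp
      then show ?thesis by (simp add: coeff_geg_poly_even Suc fact_Suc del: of_nat_Suc) (simp add: add_ac)
    qed simp
    have c2: "coeff (geg_poly a (Suc (Suc n))) l
        = (-1)^j * Gamma (real l + real j + a) * 2 ^ l / (Gamma a * fact j * fact l)"
      using n2 coeff_geg_poly_even[of a l j] by simp
    \<comment> \<open>Gamma factor shared by the polynomials of index n and n + 1; the functional
      equation reduces that of index n + 2 to it.\<close>
    define G where "G = Gamma (real l + real j - 1 + a)"
    have "real l + real j \<ge> 1" using n2 by linarith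
    then have G1: "Gamma (real l + real j + a) = (real l + real j - 1 + a) * G"
      using Gamma_real_plus1[of "real l + real j - 1 + a"] a by (simp add: G_def algebra_simps)
    have nr: "real n = real l + 2 * real j - 2" using n2 by linarith
    show ?thesis
    proof (cases j)
      case 0
      then have "coeff (geg_poly a n) l = 0" using n2 by (simp add: coeff_geg_poly)
      then show ?thesis using Ga unfolding coeff_add coeff_smult r c2 G1 G_def[symmetric] nr
        by (simp add: 0 field_simps)
    next
      case (Suc q)
      have n: "n = l + 2 * q" using n2 Suc by simp
      have c0: "coeff (geg_poly a n) l = - ((-1)^j * G * real j * 2 ^ l / (Gamma a * fact j * fact l))"
        unfolding n coeff_geg_poly_even by (simp add: Suc G_def fact_Suc del: of_nat_Suc) (simp add: add_ac mult_ac)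
      show ?thesis using Ga unfolding coeff_add coeff_smult r c2 c0 G1 G_def[symmetric] nr
        by (simp add: divide_simps) (simp add: algebra_simps)
    qed
  qed
qed

lemma geg_poly_ode:
  assumes a: "a > 0"
  shows "[:1, 0, -1:] * pderiv (pderiv (geg_poly a n))
     = Polynomial.smult (2 * a + 1) (pCons 0 (pderiv (geg_poly a n)))
       - Polynomial.smult (real n * (real n + 2 * a)) (geg_poly a n)"
proof (rule poly_eqI)
  fix l
  let ?c = "coeff (geg_poly a n)"
  have Ga: "Gamma a \<noteq> 0" by (rule Gamma_real_nonzero[OF a])
  \<comment> \<open>The differential equation is this two-step recurrence of the coefficients; at
    \<open>l = n\<close> the factor \<open>real n - real l\<close> stops it.\<close>
  have key: "real (l + 2) * real (l + 1) * ?c (l + 2) = - ((real n - real l) * (real n + real l + 2 * a) * ?c l)"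
  proof (cases "l \<le> n \<and> even (n - l)")
    case False
    then have "\<not> (l + 2 \<le> n \<and> even (n - (l + 2)))" by auto
    with False show ?thesis by (auto simp: coeff_geg_poly)
  next
    case True
    then obtain j where "n - l = 2 * j" by (blast elim: evenE)
    then have n: "n = l + 2 * j" using True by auto
    show ?thesis
    proof (cases j)
      case 0
      then show ?thesis using n by (simp add: coeff_geg_poly)
    next
      case (Suc q)
      define G where "G = Gamma (real l + real j + a)"
      have G1: "Gamma (real l + real j + 1 + a) = (real l + real j + a) * G"
        using Gamma_real_plus1[of "real l + real j + a"] a by (simp add: G_def algebra_simps)
      have n': "n = (l + 2) + 2 * q" using n Suc by simp
      have c: "?c l = (-1)^j * G * 2 ^ l / (Gamma a * fact j * fact l)"
        unfolding n coeff_geg_poly_even by (simp add: G_def)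
      have fl: "fact (l + 2) = (real l + 2) * (real l + 1) * fact l"
        by (simp add: fact_Suc algebra_simps)
      have "?c (l + 2) = (-1)^q * Gamma (real l + real j + 1 + a) * 2 ^ (l + 2) / (Gamma a * fact q * fact (l + 2))"
        unfolding n' coeff_geg_poly_even by (simp add: Suc add_ac)
      also have "\<dots> = - ((-1)^j * (real l + real j + a) * G * real j * (4 * 2 ^ l)
                      / (Gamma a * fact j * ((real l + 2) * (real l + 1) * fact l)))"
        unfolding G1 fl by (simp add: Suc fact_Suc del: of_nat_Suc) (simp add: mult_ac)
      finally have c2: "?c (l + 2) = \<dots>" .
      have nr: "real n = real l + 2 * real j" using n by simp
      show ?thesis using Ga unfolding c c2 nr
        by (simp add: divide_simps) (simp add: algebra_simps)
    qed
  qed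
  have "coeff ([:1, 0, -1:] * pderiv (pderiv (geg_poly a n))) l
      = real (l + 2) * real (l + 1) * ?c (l + 2) - real l * (real l - 1) * ?c l"
    by (cases l; cases "l - 1")
       (auto simp: coeff_pderiv coeff_pCons numeral_2_eq_2 algebra_simps)
  also have "\<dots> = coeff (Polynomial.smult (2 * a + 1) (pCons 0 (pderiv (geg_poly a n)))
       - Polynomial.smult (real n * (real n + 2 * a)) (geg_poly a n)) l"
    unfolding key
    by (cases l) (auto simp: coeff_pderiv coeff_pCons algebra_simps)
  finally show "coeff ([:1, 0, -1:] * pderiv (pderiv (geg_poly a n))) l = \<dots>" .
qed

lemma geg_poly_0: "a > 0 \<Longrightarrow> geg_poly a 0 = 1"
  using Gamma_real_nonzero[of a] by (simp add: geg_poly_def)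

lemma geg_poly_1:
  assumes "a > 0"
  shows "geg_poly a (Suc 0) = [:0, 2 * a:]"
proof -
  have "Gamma (1 + a) = a * Gamma a" "Gamma a \<noteq> 0"
    using assms Gamma_real_nonzero[of a] Gamma_real_plus1[of a] by (auto simp: add.commute)
  then show ?thesis by (simp add: geg_poly_def monom_Suc monom_0)
qed

lemma alph_pos [simp]: "alph k > 0"
  by (simp add: alph_def add_nonneg_pos)

section \<open>Weighted primitives of products and the Wronskian formula\<close>

definition poly_primitive :: "real poly \<Rightarrow> real poly" where
  "poly_primitive p = (\<Sum>i\<le>degree p. monom (coeff p i / real (Suc i)) (Suc i))"

lemma pderiv_poly_primitive [simp]: "pderiv (poly_primitive p) = p"
proof -
  have "pderiv (poly_primitive p) = (\<Sum>i\<le>degree p. monom (coeff p i) i)"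
    unfolding poly_primitive_def
    by (simp add: higher_pderiv_sum[of "Suc 0", simplified] pderiv_monom del: of_nat_Suc)
  then show ?thesis by (simp add: poly_as_sum_of_monoms)
qed

abbreviation gegC1 :: "nat \<Rightarrow> nat \<Rightarrow> real \<Rightarrow> real" where
  "gegC1 k i \<equiv> poly (pderiv (geg_poly (alph k) i))"

abbreviation gegC2 :: "nat \<Rightarrow> nat \<Rightarrow> real \<Rightarrow> real" where
  "gegC2 k i \<equiv> poly (pderiv (pderiv (geg_poly (alph k) i)))"

lemma gegC_eq_poly: "gegC a i = poly (geg_poly a i)"
  by (simp add: fun_eq_iff)

lemma DERIV_gegC [derivative_intros]:
  "(gegC (alph k) i has_real_derivative gegC1 k i z) (at z)"
  unfolding gegC_eq_poly by (rule poly_DERIV)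

lemma DERIV_gegC1: "(gegC1 k i has_real_derivative gegC2 k i z) (at z)"
  by (rule poly_DERIV)

text \<open>Pearson equation of the weight. Multiplying by 1 - z^2 hides the exponent
  \<open>k - 1\<close>, which truncates at \<open>k = 0\<close>.\<close>

lemma DERIV_gegW: "\<exists>w. (gegW k has_real_derivative w) (at z) \<and> (1 - z\<^sup>2) * w = - 2 * real k * z * gegW k z"
proof (intro exI conjI)
  show "(gegW k has_real_derivative (real k * (- 2 * z) * (1 - z\<^sup>2) ^ (k - 1))) (at z)"
    unfolding gegW_def by (auto intro!: derivative_eq_intros)
  show "(1 - z\<^sup>2) * (real k * (- 2 * z) * (1 - z\<^sup>2) ^ (k - 1)) = - 2 * real k * z * gegW k z"
    by (cases k) (simp_all add: gegW_def algebra_simps)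
qed

text \<open>The function (1 - z^2) W is the coefficient of the self-adjoint form ((1 - z^2) W C')' =
  - ev W C of the Gegenbauer equation.\<close>

lemma DERIV_weight_Suc:
  "((\<lambda>z. (1 - z\<^sup>2) * gegW k z) has_real_derivative - (2 * alph k + 1) * z * gegW k z) (at z)"
proof -
  obtain w where w: "(gegW k has_real_derivative w) (at z)" "(1 - z\<^sup>2) * w = - 2 * real k * z * gegW k z"
    using DERIV_gegW by blast
  have "((\<lambda>z. (1 - z\<^sup>2) * gegW k z) has_real_derivative (-2 * z * gegW k z + (1 - z\<^sup>2) * w)) (at z)"
    by (auto intro!: derivative_eq_intros w(1))
  then show ?thesis unfolding w(2) by (simp add: alph_def algebra_simps)
qed

lemma continuous_on_gegC [continuous_intros]: "continuous_on S (gegC a i)"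
  unfolding gegC_eq_poly by (intro continuous_intros)

lemma continuous_on_gegW [continuous_intros]: "continuous_on S (gegW k)"
  unfolding gegW_def by (intro continuous_intros)

lemma gegC_ode:
  "(1 - z\<^sup>2) * gegC2 k i z = (2 * alph k + 1) * z * gegC1 k i z
     - real i * (real i + 2 * alph k) * gegC (alph k) i z"
  using arg_cong[OF geg_poly_ode[of "alph k" i], of "\<lambda>p. poly p z"]
  by (simp add: algebra_simps power2_eq_square)

abbreviation geg_rho_poly :: "nat \<Rightarrow> nat \<Rightarrow> nat \<Rightarrow> real poly" where
  "geg_rho_poly k i j \<equiv>
     poly_primitive (geg_poly (alph k) i * geg_poly (alph k) j * [:1, 0, -1:] ^ k)"

lemma poly_weight: "poly ([:1, 0, -1:] ^ k) z = gegW k z"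
  by (simp add: gegW_def power2_eq_square)

text \<open>Valid on the whole line, also left of -1 where the integral is oriented, so \<rho> is a
  polynomial; the constant of the primitive cancels.\<close>

lemma geg_rho_eq: "geg_rho k i j z = poly (geg_rho_poly k i j) z - poly (geg_rho_poly k i j) (-1)"
  unfolding geg_rho_def
proof (rule interval_integral_FTC_finite)
  fix x
  have "(poly (geg_rho_poly k i j) has_real_derivative
      gegC (alph k) i x * gegC (alph k) j x * gegW k x) (at x)"
    using poly_DERIV[of "geg_rho_poly k i j" x] by (simp add: poly_weight del: poly_power)
  then show "(poly (geg_rho_poly k i j) has_vector_derivative
      gegC (alph k) i x * gegC (alph k) j x * gegW k x) (at x within {min (- 1) z..max (- 1) z})"
    by (simp add: has_real_derivative_iff_has_vector_derivative has_vector_derivative_at_within)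
qed (intro continuous_intros)

lemma DERIV_geg_rho:
  "(geg_rho k i j has_real_derivative gegC (alph k) i z * gegC (alph k) j z * gegW k z) (at z)"
proof -
  have "((\<lambda>z. poly (geg_rho_poly k i j) z - poly (geg_rho_poly k i j) (-1)) has_real_derivative
      gegC (alph k) i z * gegC (alph k) j z * gegW k z) (at z)"
    using poly_DERIV[of "geg_rho_poly k i j" z]
    by (auto intro!: derivative_eq_intros simp: poly_weight simp del: poly_power)
  then show ?thesis by (simp add: geg_rho_eq[abs_def])
qed

lemma geg_rho_minus_1 [simp]: "geg_rho k i j (-1) = 0"
  by (simp add: geg_rho_eq)

lemma geg_rho_commute: "geg_rho k i j z = geg_rho k j i z"
  by (simp add: geg_rho_def mult.commute)

lemma geg_rho_has_integral:
  "((\<lambda>u. gegC (alph k) i u * gegC (alph k) j u * gegW k u) has_integral (geg_rho k i j b - geg_rho k i j a)) {a..b}"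
  if "a \<le> b"
  by (rule fundamental_theorem_of_calculus[OF that])
     (metis DERIV_geg_rho has_real_derivative_iff_has_vector_derivative has_vector_derivative_at_within)

lemma DERIV_eq_imp_eq:
  fixes f g :: "real \<Rightarrow> real"
  assumes "\<And>x. (f has_real_derivative d x) (at x)" "\<And>x. (g has_real_derivative d x) (at x)" "f c = g c"
  shows "f x = g x"
proof -
  have "\<forall>x. ((\<lambda>x. f x - g x) has_real_derivative 0) (at x)"
    using assms(1,2) by (auto intro!: derivative_eq_intros)
  from DERIV_isconst_all[OF this, of x c] assms(3) show ?thesis by simp
qed

text \<open>Lagrange's identity: by the two differential equations both sides have the same
  derivative, and the factor 1 - z^2 makes the right side vanish at -1.\<close>

lemma geg_rho_wronskian:
  "(real j * (real j + 2 * alph k) - real i * (real i + 2 * alph k)) * geg_rho k i j z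
     = (1 - z\<^sup>2) * gegW k z * (gegC1 k i z * gegC (alph k) j z - gegC (alph k) i z * gegC1 k j z)"
  (is "(?lj - ?li) * _ = ?R z")
proof (rule DERIV_eq_imp_eq[where c = "-1" and f = "\<lambda>z. (?lj - ?li) * geg_rho k i j z" and g = ?R and
      d = "\<lambda>x. (?lj - ?li) * (gegC (alph k) i x * gegC (alph k) j x * gegW k x)"])
  fix x
  let ?d = "(?lj - ?li) * (gegC (alph k) i x * gegC (alph k) j x * gegW k x)"
  show "((\<lambda>z. (?lj - ?li) * geg_rho k i j z) has_real_derivative ?d) (at x)"
    by (rule DERIV_cmult) (rule DERIV_geg_rho)
  let ?w = "gegC1 k i x * gegC (alph k) j x - gegC (alph k) i x * gegC1 k j x"
  let ?w' = "gegC2 k i x * gegC (alph k) j x - gegC (alph k) i x * gegC2 k j x"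
  have "((\<lambda>x. gegC1 k i x * gegC (alph k) j x - gegC (alph k) i x * gegC1 k j x) has_real_derivative ?w') (at x)"
    by (rule DERIV_cong[OF DERIV_diff[OF DERIV_mult[OF DERIV_gegC1 DERIV_gegC] DERIV_mult[OF DERIV_gegC DERIV_gegC1]]])
       (simp add: mult_ac)
  from DERIV_mult[OF DERIV_weight_Suc this]
  have *: "(?R has_real_derivative (- (2 * alph k + 1) * x * gegW k x) * ?w + ?w' * ((1 - x\<^sup>2) * gegW k x)) (at x)" .
  have "(- (2 * alph k + 1) * x * gegW k x) * ?w + ?w' * ((1 - x\<^sup>2) * gegW k x)
     = gegW k x * (((1 - x\<^sup>2) * gegC2 k i x) * gegC (alph k) j x - gegC (alph k) i x * ((1 - x\<^sup>2) * gegC2 k j x)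
        - (2 * alph k + 1) * x * ?w)" by (simp add: algebra_simps)
  also have "\<dots> = ?d" unfolding gegC_ode by (simp add: algebra_simps)
  finally show "(?R has_real_derivative ?d) (at x)" using * by simp
qed (simp add: gegW_def)

lemma geg_eigenvalue_inj:
  "real j * (real j + 2 * alph k) = real i * (real i + 2 * alph k) \<longleftrightarrow> i = j"
proof -
  have "real j * (real j + 2 * alph k) - real i * (real i + 2 * alph k) = (real j - real i) * (real i + real j + 2 * alph k)"
    by (simp add: algebra_simps)
  moreover have "real i + real j + 2 * alph k > 0" by (simp add: add_nonneg_pos)
  ultimately show ?thesis by auto
qed

section \<open>Orthogonality and squared norms of the classical polynomials\<close>

lemma geg_rho_1_offdiag: "i \<noteq> j \<Longrightarrow> geg_rho k i j 1 = 0"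
  using geg_rho_wronskian[of j k i 1] by (simp add: geg_eigenvalue_inj)

text \<open>Both norms are multiples of one mixed moment \<open>X\<close>: the three-term relation
  centred at n + 1 is integrated against the polynomial of index n, the one centred at n against
  that of index n + 1, and orthogonality kills the third term.\<close>

lemma geg_rho_1_ratio:
  "real (Suc n) * (real (Suc n) + alph k) * geg_rho k (Suc n) (Suc n) 1
     = (real n + alph k) * (real n + 2 * alph k) * geg_rho k n n 1"
proof -
  define a where "a = alph k"
  have a: "a > 0" by (simp add: a_def)
  let ?I = "\<lambda>f. integral {-1..1} f :: real"
  define X where "X = ?I (\<lambda>u. u * gegC a n u * gegC a (Suc n) u * gegW k u)"
  have I: "((\<lambda>u. gegC a i u * gegC a j u * gegW k u) has_integral geg_rho k i j 1) {-1..1}" for i j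
    using geg_rho_has_integral[of "-1" 1] by (simp add: a_def)
  have X: "((\<lambda>u. u * gegC a n u * gegC a (Suc n) u * gegW k u) has_integral X) {-1..1}"
    unfolding X_def by (intro integrable_integral integrable_continuous_real continuous_intros)
  have R: "(real n + 2) * gegC a (Suc (Suc n)) z + (real n + 2 * a) * gegC a n z
      = 2 * (real n + 1 + a) * (z * gegC a (Suc n) z)" for n z
    using arg_cong[OF geg_poly_three_term[OF a, of n], of "\<lambda>p. poly p z"] by (simp add: algebra_simps)
  have A: "((\<lambda>u. ((real n + 2) * gegC a (Suc (Suc n)) u + (real n + 2 * a) * gegC a n u) * (gegC a n u * gegW k u))
      has_integral ((real n + 2) * geg_rho k (Suc (Suc n)) n 1 + (real n + 2 * a) * geg_rho k n n 1)) {-1..1}"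
    using has_integral_add[OF has_integral_mult_right[OF I[of "Suc (Suc n)" n], of "real n + 2"] has_integral_mult_right[OF I[of n n], of "real n + 2 * a"]]
    by (simp add: algebra_simps)
  have B: "((\<lambda>u. ((real n + 2) * gegC a (Suc (Suc n)) u + (real n + 2 * a) * gegC a n u) * (gegC a n u * gegW k u))
      has_integral (2 * (real n + 1 + a) * X)) {-1..1}"
    unfolding R using has_integral_mult_right[OF X, of "2 * (real n + 1 + a)"] by (simp add: algebra_simps)
  have 1: "(real n + 2 * a) * geg_rho k n n 1 = 2 * (real n + 1 + a) * X"
    using has_integral_unique[OF A B] geg_rho_1_offdiag[of "Suc (Suc n)" n k] by simp
  have 2: "(real n + 1) * geg_rho k (Suc n) (Suc n) 1 = 2 * (real n + a) * X"
  proof (cases n)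
    \<comment> \<open>There is no polynomial of index -1, so the explicit form 2 a z of the first
      polynomial replaces the recurrence.\<close>
    case 0
    have "geg_rho k (Suc 0) (Suc 0) 1 = 2 * a * X"
    proof (rule has_integral_unique[OF I])
      show "((\<lambda>u. gegC a (Suc 0) u * gegC a (Suc 0) u * gegW k u) has_integral 2 * a * X) {-1..1}"
        using has_integral_mult_right[OF X, of "2 * a"] a
        by (simp add: 0 gegC_eq_poly geg_poly_1 geg_poly_0 mult_ac)
    qed
    then show ?thesis by (simp add: 0)
  next
    case (Suc q)
    have A: "((\<lambda>u. ((real q + 2) * gegC a (Suc (Suc q)) u + (real q + 2 * a) * gegC a q u) * (gegC a (Suc n) u * gegW k u))
        has_integral ((real q + 2) * geg_rho k (Suc (Suc q)) (Suc n) 1 + (real q + 2 * a) * geg_rho k q (Suc n) 1)) {-1..1}"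
      using has_integral_add[OF has_integral_mult_right[OF I[of "Suc (Suc q)" "Suc n"], of "real q + 2"] has_integral_mult_right[OF I[of q "Suc n"], of "real q + 2 * a"]]
      by (simp add: algebra_simps)
    have B: "((\<lambda>u. ((real q + 2) * gegC a (Suc (Suc q)) u + (real q + 2 * a) * gegC a q u) * (gegC a (Suc n) u * gegW k u))
        has_integral (2 * (real q + 1 + a) * X)) {-1..1}"
      unfolding R using has_integral_mult_right[OF X, of "2 * (real q + 1 + a)"] by (simp add: algebra_simps Suc)
    show ?thesis
      using has_integral_unique[OF A B] geg_rho_1_offdiag[of q "Suc n" k] by (simp add: Suc add_ac)
  qed
  have "real (Suc n) * (real (Suc n) + a) * geg_rho k (Suc n) (Suc n) 1
      = (real n + 1 + a) * ((real n + 1) * geg_rho k (Suc n) (Suc n) 1)" by (simp add: algebra_simps)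
  also have "\<dots> = (real n + a) * (2 * (real n + 1 + a) * X)" unfolding 2 by (simp add: algebra_simps)
  also have "\<dots> = (real n + a) * (real n + 2 * a) * geg_rho k n n 1" unfolding 1[symmetric] by simp
  finally show ?thesis by (simp add: a_def)
qed

text \<open>Integrate the derivative of x (1 - x^2)^(k+1), whose boundary values vanish, after
  replacing x^2 by 1 - (1 - x^2).\<close>

lemma geg_rho_1_0_Suc:
  "(2 * real k + 3) * geg_rho (Suc k) 0 0 1 = 2 * (real k + 1) * geg_rho k 0 0 1"
proof -
  have I: "((\<lambda>u. (1 - u\<^sup>2) ^ k) has_integral geg_rho k 0 0 1) {-1..1}" for k
    using geg_rho_has_integral[of "-1" 1 k 0 0] by (simp add: gegC_eq_poly geg_poly_0 gegW_def)
  have "((\<lambda>u. (2 * real k + 3) * (1 - u\<^sup>2) ^ Suc k - 2 * (real k + 1) * (1 - u\<^sup>2) ^ k) has_integral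
     (1 * (1 - 1\<^sup>2) ^ Suc k - (-1) * (1 - (-1)\<^sup>2) ^ Suc k)) {-1..1::real}"
  proof (rule fundamental_theorem_of_calculus)
    fix x :: real
    have "((\<lambda>x. x * (1 - x\<^sup>2) ^ Suc k) has_real_derivative
        (2 * real k + 3) * (1 - x\<^sup>2) ^ Suc k - 2 * (real k + 1) * (1 - x\<^sup>2) ^ k) (at x)"
      by (rule DERIV_cong[OF DERIV_mult[OF DERIV_ident DERIV_power_Suc]])
         (auto intro!: derivative_eq_intros simp: algebra_simps power2_eq_square)
    then show "((\<lambda>x. x * (1 - x\<^sup>2) ^ Suc k) has_vector_derivative
        (2 * real k + 3) * (1 - x\<^sup>2) ^ Suc k - 2 * (real k + 1) * (1 - x\<^sup>2) ^ k) (at x within {-1..1})"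
      by (simp only: has_real_derivative_iff_has_vector_derivative has_vector_derivative_at_within)
  qed simp
  from has_integral_unique[OF this has_integral_diff[OF has_integral_mult_right[OF I] has_integral_mult_right[OF I]]]
  show ?thesis by simp
qed

text \<open>Induction on \<open>k\<close> climbs from \<alpha> = 1/2, where the weight is 1 and the
  norm is the interval length 2; the step matches the recursion of the integral with the functional
  equation of Gamma.\<close>

lemma geg_nu_0: "geg_nu (alph k) 0 = geg_rho k 0 0 1"
proof (induction k)
  case 0
  have "geg_rho 0 0 0 1 = 2"
    using geg_rho_has_integral[of "-1" 1 0 0 0] has_integral_const_real[of "1::real" "-1" 1]
    by (auto simp: gegC_eq_poly geg_poly_0 gegW_def dest: has_integral_unique)
  then show ?case
    by (simp add: geg_nu_def alph_def Gamma_one_half_real)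
next
  case (Suc k)
  define a where "a = alph k"
  have a: "a > 0" by (simp add: a_def)
  have S: "alph (Suc k) = a + 1" by (simp add: a_def alph_def)
  have g1: "Gamma (a + 1) = a * Gamma a" by (rule Gamma_real_plus1[OF a])
  have g2: "Gamma (2 * a + 2) = (2 * a + 1) * (2 * a) * Gamma (2 * a)"
    using Gamma_real_plus1[of "2 * a + 1"] Gamma_real_plus1[of "2 * a"] a
    by (simp add: add_ac)
  have p: "2 powr (1 - 2 * (a + 1)) = 2 powr (1 - 2 * a) / (4::real)"
    by (simp add: algebra_simps powr_diff)
  have G: "Gamma a \<noteq> 0" "Gamma (2 * a) \<noteq> 0" using a by (auto intro!: Gamma_real_nonzero)
  have "geg_nu (a + 1) 0 = pi * (2 powr (1 - 2 * a) / 4) * ((2 * a + 1) * (2 * a) * Gamma (2 * a)) / ((a + 1) * (a * Gamma a)\<^sup>2)"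
    unfolding geg_nu_def p g1 using g2 by (simp add: algebra_simps)
  also have "\<dots> = (2 * a + 1) / (2 * a + 2) * geg_nu a 0"
    using a G by (simp add: geg_nu_def divide_simps power2_eq_square)
  also have "\<dots> = geg_rho (Suc k) 0 0 1"
    using geg_rho_1_0_Suc[of k] Suc by (simp add: a_def alph_def field_simps)
  finally show ?case by (simp add: S)
qed

lemma geg_rho_1_diag: "geg_rho k n n 1 = geg_nu (alph k) n"
proof (induction n)
  case 0
  then show ?case by (simp add: geg_nu_0)
next
  case (Suc n)
  define a where "a = alph k"
  have a: "a > 0" by (simp add: a_def)
  have g: "Gamma (real n + 1 + 2 * a) = (real n + 2 * a) * Gamma (real n + 2 * a)"
    using Gamma_real_plus1[of "real n + 2 * a"] a by (simp add: add_ac)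
  have nz: "real (Suc n) * (real (Suc n) + a) > 0" using a by (intro mult_pos_pos) auto
  have "real (Suc n) * (real (Suc n) + a) * geg_nu a (Suc n) = (real n + a) * (real n + 2 * a) * geg_nu a n"
    using a Gamma_real_nonzero[OF a] g
    by (simp add: geg_nu_def fact_Suc divide_simps power2_eq_square del: of_nat_Suc) (simp add: algebra_simps)
  then have "real (Suc n) * (real (Suc n) + a) * geg_rho k (Suc n) (Suc n) 1 = real (Suc n) * (real (Suc n) + a) * geg_nu a (Suc n)"
    using geg_rho_1_ratio[of n k] Suc by (simp add: a_def)
  then show ?case using nz by (metis mult_left_cancel less_irrefl a_def)
qed

lemma geg_nu_pos: "geg_nu (alph k) i > 0"
  unfolding geg_nu_def
  by (intro divide_pos_pos mult_pos_pos zero_less_power Gamma_real_pos add_nonneg_pos) auto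

section \<open>Determinants and adjugates with polynomial entries\<close>

text \<open>The matrices have real functions as entries. A predicate closed under ring operations
  carries polynomiality through Leibniz sums and minors.\<close>

definition polyfun :: "(real \<Rightarrow> real) \<Rightarrow> bool" where
  "polyfun f \<longleftrightarrow> (\<exists>p. \<forall>z. f z = poly p z)"

named_theorems polyfun_intros

lemma polyfun_poly [polyfun_intros]: "polyfun (poly p)"
  by (auto simp: polyfun_def)

lemma polyfun_const [polyfun_intros]: "polyfun (\<lambda>z. c)"
  unfolding polyfun_def by (rule exI[of _ "[:c:]"]) simp

lemma polyfun_add [polyfun_intros]: "polyfun f \<Longrightarrow> polyfun g \<Longrightarrow> polyfun (\<lambda>z. f z + g z)"
  unfolding polyfun_def by (metis poly_add)

lemma polyfun_diff [polyfun_intros]: "polyfun f \<Longrightarrow> polyfun g \<Longrightarrow> polyfun (\<lambda>z. f z - g z)"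
  unfolding polyfun_def by (metis poly_diff)

lemma polyfun_mult [polyfun_intros]: "polyfun f \<Longrightarrow> polyfun g \<Longrightarrow> polyfun (\<lambda>z. f z * g z)"
  unfolding polyfun_def by (metis poly_mult)

lemma polyfun_sum [polyfun_intros]:
  "(\<And>i. i \<in> I \<Longrightarrow> polyfun (f i)) \<Longrightarrow> polyfun (\<lambda>z. \<Sum>i\<in>I. f i z)"
  by (induction I rule: infinite_finite_induct) (auto intro!: polyfun_intros)

lemma polyfun_prod [polyfun_intros]:
  "(\<And>i. i \<in> I \<Longrightarrow> polyfun (f i)) \<Longrightarrow> polyfun (\<lambda>z. \<Prod>i\<in>I. f i z)"
  by (induction I rule: infinite_finite_induct) (auto intro!: polyfun_intros)

lemma polyfun_gegC [polyfun_intros]: "polyfun (gegC a i)"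
  unfolding gegC_eq_poly by (intro polyfun_intros)

lemma polyfun_geg_rho [polyfun_intros]: "polyfun (geg_rho k i j)"
proof -
  have "polyfun (\<lambda>z. poly (geg_rho_poly k i j) z - poly (geg_rho_poly k i j) (-1))"
    by (intro polyfun_intros)
  then show ?thesis by (simp add: polyfun_def geg_rho_eq)
qed

lemma polyfun_det:
  assumes "\<And>z. A z \<in> carrier_mat n n"
    and "\<And>i j. i < n \<Longrightarrow> j < n \<Longrightarrow> polyfun (\<lambda>z. A z $$ (i, j))"
  shows "polyfun (\<lambda>z. Determinant.det (A z))"
proof -
  have "p i < n" if "p permutes {0..<n}" "i \<in> {0..<n}" for p i
    using that permutes_in_image[of p "{0..<n}" i] by auto
  then show ?thesis
    unfolding det_def'[OF assms(1)]
    by (auto intro!: polyfun_intros assms(2))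
qed

lemma polyfun_adj_mat:
  assumes A: "\<And>z. A z \<in> carrier_mat n n"
    and p: "\<And>i j. i < n \<Longrightarrow> j < n \<Longrightarrow> polyfun (\<lambda>z. A z $$ (i, j))"
    and ij: "i < n" "j < n"
  shows "polyfun (\<lambda>z. adj_mat (A z) $$ (i, j))"
proof -
  have eq: "adj_mat (A z) $$ (i, j) = (-1)^(j+i) * Determinant.det (mat_delete (A z) j i)" for z
    using A[of z] ij by (auto simp: adj_mat_def cofactor_def)
  have "polyfun (\<lambda>z. Determinant.det (mat_delete (A z) j i))"
  proof (rule polyfun_det[where n = "n - 1"])
    show "mat_delete (A z) j i \<in> carrier_mat (n - 1) (n - 1)" for z
      by (rule mat_delete_carrier) (rule A)
    fix a b assume ab: "a < n - 1" "b < n - 1"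
    have e: "mat_delete (A z) j i $$ (a, b)
        = A z $$ (if a < j then a else Suc a, if b < i then b else Suc b)" for z
      using A[of z] ab by (auto simp: mat_delete_def)
    show "polyfun (\<lambda>z. mat_delete (A z) j i $$ (a, b))"
      unfolding e by (rule p) (use ab in auto)
  qed
  then show ?thesis unfolding eq by (intro polyfun_intros)
qed

text \<open>Jacobi's formula. In the Leibniz sum the product rule differentiates one row at a time;
  the terms for row \<open>i\<close> form the determinant \<open>N\<close> with that row replaced by
  its derivative, which is then expanded along it.\<close>

lemma DERIV_det:
  fixes A :: "real \<Rightarrow> real mat"
  assumes A: "\<And>z. A z \<in> carrier_mat n n"
    and D: "\<And>i j. i < n \<Longrightarrow> j < n \<Longrightarrow> ((\<lambda>z. A z $$ (i, j)) has_real_derivative D i j) (at z)"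
  shows "((\<lambda>z. Determinant.det (A z)) has_real_derivative
           (\<Sum>i<n. \<Sum>j<n. D i j * cofactor (A z) i j)) (at z)"
proof -
  let ?P = "{p. p permutes {0..<n}}"
  have pn: "p i < n" if "p \<in> ?P" "i \<in> {0..<n}" for p i
    using that permutes_in_image[of p "{0..<n}" i] by auto
  have row: "(\<Sum>p\<in>?P. signof p * (D i (p i) * (\<Prod>l\<in>{0..<n} - {i}. A z $$ (l, p l))))
      = (\<Sum>j<n. D i j * cofactor (A z) i j)" if i: "i < n" for i
  proof -
    define N where "N = Matrix.mat n n (\<lambda>(l, j). if l = i then D i j else A z $$ (l, j))"
    have N: "N \<in> carrier_mat n n" by (simp add: N_def)
    have "Determinant.det N = (\<Sum>p\<in>?P. signof p * (D i (p i) * (\<Prod>l\<in>{0..<n} - {i}. A z $$ (l, p l))))"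
      unfolding det_def'[OF N]
    proof (rule sum.cong[OF refl])
      fix p assume p: "p \<in> ?P"
      have "(\<Prod>l\<in>{0..<n}. N $$ (l, p l)) = N $$ (i, p i) * (\<Prod>l\<in>{0..<n} - {i}. N $$ (l, p l))"
        using i by (intro prod.remove) auto
      also have "N $$ (i, p i) = D i (p i)" using i pn[OF p] by (simp add: N_def)
      also have "(\<Prod>l\<in>{0..<n} - {i}. N $$ (l, p l)) = (\<Prod>l\<in>{0..<n} - {i}. A z $$ (l, p l))"
        using pn[OF p] by (intro prod.cong) (auto simp: N_def)
      finally show "signof p * (\<Prod>l\<in>{0..<n}. N $$ (l, p l)) =
          signof p * (D i (p i) * (\<Prod>l\<in>{0..<n} - {i}. A z $$ (l, p l)))" by simp
    qed
    moreover have "Determinant.det N = (\<Sum>j<n. N $$ (i, j) * cofactor N i j)"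
      by (rule laplace_expansion_row[OF N i])
    moreover have "\<dots> = (\<Sum>j<n. D i j * cofactor (A z) i j)"
    proof (intro sum.cong refl)
      fix j assume j: "j \<in> {..<n}"
      have "mat_delete N i j = mat_delete (A z) i j"
        using A[of z] i j by (auto simp: mat_delete_def N_def)
      then show "N $$ (i, j) * cofactor N i j = D i j * cofactor (A z) i j"
        using i j by (simp add: N_def cofactor_def)
    qed
    ultimately show ?thesis by simp
  qed
  have "((\<lambda>z. \<Sum>p\<in>?P. signof p * (\<Prod>i\<in>{0..<n}. A z $$ (i, p i))) has_real_derivative
     (\<Sum>p\<in>?P. signof p * (\<Sum>i\<in>{0..<n}. D i (p i) * (\<Prod>l\<in>{0..<n} - {i}. A z $$ (l, p l))))) (at z)"
    using pn by (intro DERIV_sum DERIV_cmult has_field_derivative_prod D) auto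
  also have "(\<Sum>p\<in>?P. signof p * (\<Sum>i\<in>{0..<n}. D i (p i) * (\<Prod>l\<in>{0..<n} - {i}. A z $$ (l, p l))))
      = (\<Sum>i\<in>{0..<n}. \<Sum>p\<in>?P. signof p * (D i (p i) * (\<Prod>l\<in>{0..<n} - {i}. A z $$ (l, p l))))"
    unfolding sum_distrib_left by (rule sum.swap)
  also have "\<dots> = (\<Sum>i<n. \<Sum>j<n. D i j * cofactor (A z) i j)"
    by (rule sum.cong) (auto simp: row)
  finally show ?thesis by (simp add: det_def'[OF A])
qed

section \<open>The matrix \<open>Rmat\<close>, its kernel and Cramer's rule\<close>

lemma Rmat_carrier [simp]: "Rmat k m ts z \<in> carrier_mat (length m) (length m)"
  by (simp add: Rmat_def)

lemma dim_Rmat [simp]: "dim_row (Rmat k m ts z) = length m" "dim_col (Rmat k m ts z) = length m"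
  by (simp_all add: Rmat_def)

lemma Rmat_index:
  "a < length m \<Longrightarrow> b < length m \<Longrightarrow>
     Rmat k m ts z $$ (a, b) = (if a = b then 1 else 0) + ts ! b * geg_rho k (m ! a) (m ! b) z"
  by (simp add: Rmat_def)

lemma polyfun_Rmat [polyfun_intros]:
  "a < length m \<Longrightarrow> b < length m \<Longrightarrow> polyfun (\<lambda>z. Rmat k m ts z $$ (a, b))"
  unfolding Rmat_index by (intro polyfun_intros)

lemma polyfun_tau_m: "polyfun (tau_m k m ts)"
  using polyfun_det[of "Rmat k m ts" "length m"] by (simp add: tau_m_def[abs_def] polyfun_Rmat)

lemma sum_set_nth:
  "distinct m \<Longrightarrow> (\<Sum>b\<in>set m. f b) = (\<Sum>b<length m. f (m ! b))"
  by (rule sum.reindex_bij_betw[symmetric]) (simp add: bij_betw_nth)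

lemma mult_mat_vec_sum:
  "A \<in> carrier_mat n l \<Longrightarrow> v \<in> carrier_vec l \<Longrightarrow> a < n \<Longrightarrow>
     (A *\<^sub>v v) $ a = (\<Sum>b<l. A $$ (a, b) * v $ b)"
  by (auto simp: scalar_prod_def atLeast0LessThan)

text \<open>Passes from positions in the list to members of \<open>m\<close>: by distinctness a
  kernel vector is a function on \<open>set m\<close>, and later arguments work with sums over that
  set.\<close>

lemma tau_m_eq_0_iff:
  assumes m: "distinct m"
  shows "tau_m k m (map t m) z = 0 \<longleftrightarrow>
    (\<exists>y. (\<exists>i\<in>set m. y i \<noteq> 0) \<and> (\<forall>i\<in>set m. y i + (\<Sum>b\<in>set m. geg_rho k i b z * t b * y b) = 0))"
proof -
  let ?n = "length m" and ?R = "Rmat k m (map t m) z"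
  have Rv: "(?R *\<^sub>v v) $ a = y (m ! a) + (\<Sum>b\<in>set m. geg_rho k (m ! a) b z * t b * y b)"
    if "v \<in> carrier_vec ?n" "a < ?n" "\<And>b. b < ?n \<Longrightarrow> v $ b = y (m ! b)" for v a y
  proof -
    have "(?R *\<^sub>v v) $ a = (\<Sum>b<?n. (if a = b then y (m ! a) else 0) + geg_rho k (m ! a) (m ! b) z * t (m ! b) * y (m ! b))"
      unfolding mult_mat_vec_sum[OF Rmat_carrier that(1,2)]
      by (rule sum.cong) (use that in \<open>auto simp: Rmat_index algebra_simps\<close>)
    then show ?thesis using that(2) by (simp add: sum.distrib sum_set_nth[OF m])
  qed
  show ?thesis
    unfolding tau_m_def det_0_iff_vec_prod_zero[OF Rmat_carrier]
  proof (intro iffI; elim exE conjE)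
    fix v assume v: "v \<in> carrier_vec ?n" "v \<noteq> 0\<^sub>v ?n" "?R *\<^sub>v v = 0\<^sub>v ?n"
    \<comment> \<open>Outside \<open>set m\<close> the inverse is an arbitrary position, but only
      values on \<open>set m\<close> are ever used.\<close>
    define y where "y i = v $ (inv_into {..<?n} ((!) m) i)" for i
    have inj: "inj_on ((!) m) {..<?n}" using m by (simp add: inj_on_nth)
    have y: "v $ b = y (m ! b)" if "b < ?n" for b
      using that by (simp add: y_def inv_into_f_f[OF inj])
    obtain b where "b < ?n" "v $ b \<noteq> 0" using v(1,2) by (metis carrier_vecD eq_vecI index_zero_vec)
    then have ex: "\<exists>i\<in>set m. y i \<noteq> 0" using y[of b] by (intro bexI[of _ "m ! b"]) auto
    have "y i + (\<Sum>b\<in>set m. geg_rho k i b z * t b * y b) = 0" if "i \<in> set m" for i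
    proof -
      obtain a where a: "a < ?n" "i = m ! a" using \<open>i \<in> set m\<close> by (auto simp: in_set_conv_nth)
      have "(?R *\<^sub>v v) $ a = 0" unfolding v(3) using a(1) by simp
      then show ?thesis unfolding a(2) using Rv[where y = y, OF v(1) a(1)] y by simp
    qed
    with ex show "\<exists>y. (\<exists>i\<in>set m. y i \<noteq> 0) \<and> (\<forall>i\<in>set m. y i + (\<Sum>b\<in>set m. geg_rho k i b z * t b * y b) = 0)"
      by (intro exI[of _ y] conjI ballI)
  next
    fix y assume y: "\<exists>i\<in>set m. y i \<noteq> 0" "\<forall>i\<in>set m. y i + (\<Sum>b\<in>set m. geg_rho k i b z * t b * y b) = 0"
    define v where "v = Matrix.vec ?n (\<lambda>a. y (m ! a))"
    have v: "v \<in> carrier_vec ?n" "\<And>b. b < ?n \<Longrightarrow> v $ b = y (m ! b)" by (auto simp: v_def)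
    obtain b where b: "b < ?n" "y (m ! b) \<noteq> 0" using y(1) by (auto simp: in_set_conv_nth)
    then have "v \<noteq> 0\<^sub>v ?n" using v(2)[OF b(1)] by (metis index_zero_vec(1))
    moreover have "?R *\<^sub>v v = 0\<^sub>v ?n"
    proof (rule eq_vecI)
      fix a assume a: "a < dim_vec (0\<^sub>v ?n :: real vec)"
      then have "(?R *\<^sub>v v) $ a = 0" using Rv[OF v(1) _ v(2), of a] y(2) by simp
      then show "(?R *\<^sub>v v) $ a = 0\<^sub>v ?n $ a" using a by simp
    qed (simp add: Rmat_def)
    ultimately show "\<exists>v. v \<in> carrier_vec ?n \<and> v \<noteq> 0\<^sub>v ?n \<and> ?R *\<^sub>v v = 0\<^sub>v ?n" using v(1) by (intro exI[of _ v] conjI)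
  qed
qed

text \<open>The vector adj(R) x, indexed by members of \<open>m\<close>. Being \<tau> times the
  solution, it stays polynomial in z and is meaningful at zeros of \<tau>.\<close>

definition cramer :: "nat \<Rightarrow> nat list \<Rightarrow> (nat \<Rightarrow> real) \<Rightarrow> (nat \<Rightarrow> real) \<Rightarrow> real \<Rightarrow> nat \<Rightarrow> real" where
  "cramer k m t x z i = (\<Sum>a<length m. adj_mat (Rmat k m (map t m) z)
      $$ (inv_into {..<length m} ((!) m) i, a) * x (m ! a))"

lemma cramer_nth:
  assumes "distinct m" "c < length m"
  shows "cramer k m t x z (m ! c) = (\<Sum>a<length m. adj_mat (Rmat k m (map t m) z) $$ (c, a) * x (m ! a))"
proof -
  have "inj_on ((!) m) {..<length m}" using assms by (simp add: inj_on_nth)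
  then show ?thesis using assms by (simp add: cramer_def inv_into_f_f)
qed

lemma polyfun_cramer:
  assumes "distinct m" "i \<in> set m" "\<And>a. polyfun (\<lambda>z. x z a)"
  shows "polyfun (\<lambda>z. cramer k m t (x z) z i)"
proof -
  obtain c where c: "c < length m" "i = m ! c" using assms by (metis in_set_conv_nth)
  show ?thesis unfolding c(2) cramer_nth[OF assms(1) c(1)]
    by (intro polyfun_intros polyfun_adj_mat[where n = "length m"] Rmat_carrier assms(3) c) auto
qed

lemma cramer_solves:
  assumes m: "distinct m" and i: "i \<in> set m"
  shows "cramer k m t x z i + (\<Sum>b\<in>set m. geg_rho k i b z * t b * cramer k m t x z b)
     = tau_m k m (map t m) z * x i"
proof -
  let ?n = "length m" and ?R = "Rmat k m (map t m) z"
  obtain c where c: "c < length m" "i = m ! c" using i by (metis in_set_conv_nth)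
  have "(\<Sum>b<?n. ?R $$ (c, b) * cramer k m t x z (m ! b))
      = (\<Sum>b<?n. \<Sum>a<?n. ?R $$ (c, b) * (adj_mat ?R $$ (b, a) * x (m ! a)))"
    by (rule sum.cong) (auto simp: cramer_nth[OF m] sum_distrib_left)
  also have "\<dots> = (\<Sum>a<?n. (\<Sum>b<?n. ?R $$ (c, b) * adj_mat ?R $$ (b, a)) * x (m ! a))"
    by (subst sum.swap) (simp add: sum_distrib_right sum_distrib_left mult_ac)
  also have "\<dots> = (\<Sum>a<?n. (?R * adj_mat ?R) $$ (c, a) * x (m ! a))"
    using carrier_matD[OF adj_mat(1)[OF Rmat_carrier[of k m "map t m" z]]] c(1)
    by (intro sum.cong refl arg_cong2[of _ _ _ _ "(*)"]) (auto simp: scalar_prod_def atLeast0LessThan)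
  also have "\<dots> = (\<Sum>a<?n. if a = c then tau_m k m (map t m) z * x (m ! c) else 0)"
    unfolding adj_mat(2)[OF Rmat_carrier] using c(1) by (intro sum.cong) (auto simp: tau_m_def)
  also have "\<dots> = tau_m k m (map t m) z * x i" using c by simp
  finally have "(\<Sum>b<?n. ?R $$ (c, b) * cramer k m t x z (m ! b)) = tau_m k m (map t m) z * x i" .
  moreover have "(\<Sum>b<?n. ?R $$ (c, b) * cramer k m t x z (m ! b))
     = (\<Sum>b<?n. (if b = c then cramer k m t x z i else 0) + geg_rho k i (m ! b) z * t (m ! b) * cramer k m t x z (m ! b))"
    by (rule sum.cong) (use c in \<open>auto simp: Rmat_index algebra_simps\<close>)
  ultimately show ?thesis using c by (simp add: sum.distrib sum_set_nth[OF m])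
qed

text \<open>The derivative of the entry at (a, b) is a product of a factor in \<open>a\<close> and a
  factor in \<open>b\<close>, so the cofactor sum of Jacobi's formula collapses to the Cramer vector
  for the right-hand side \<open>C\<close>.\<close>

lemma DERIV_tau_m:
  assumes m: "distinct m"
  shows "(tau_m k m (map t m) has_real_derivative gegW k z *
     (\<Sum>b\<in>set m. t b * gegC (alph k) b z * cramer k m t (\<lambda>i. gegC (alph k) i z) z b)) (at z)"
proof -
  let ?n = "length m" and ?R = "Rmat k m (map t m)" and ?C = "\<lambda>i. gegC (alph k) i z"
  let ?D = "\<lambda>a b. t (m ! b) * (?C (m ! a) * ?C (m ! b) * gegW k z)"
  have "(tau_m k m (map t m) has_real_derivative (\<Sum>a<?n. \<Sum>b<?n. ?D a b * cofactor (?R z) a b)) (at z)"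
    unfolding tau_m_def[abs_def]
  proof (rule DERIV_det)
    fix a b assume "a < ?n" "b < ?n"
    then show "((\<lambda>z. ?R z $$ (a, b)) has_real_derivative ?D a b) (at z)"
      by (auto simp: Rmat_index intro!: derivative_eq_intros DERIV_geg_rho)
  qed simp
  also have "(\<Sum>a<?n. \<Sum>b<?n. ?D a b * cofactor (?R z) a b)
      = (\<Sum>b<?n. \<Sum>a<?n. gegW k z * (t (m ! b) * ?C (m ! b) * (adj_mat (?R z) $$ (b, a) * ?C (m ! a))))"
    by (subst sum.swap, intro sum.cong refl) (simp add: adj_mat_def Rmat_def)
  also have "\<dots> = gegW k z * (\<Sum>b\<in>set m. t b * ?C b * cramer k m t ?C z b)"
    by (simp add: sum_set_nth[OF m] cramer_nth[OF m] sum_distrib_left)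
  finally show ?thesis .
qed

lemma polyfun_gegCm: "polyfun (gegCm k m ts i)"
proof -
  let ?n = "length m" and ?R = "Rmat k (m @ [i]) (ts @ [0])"
  have "gegCm k m ts i z = (\<Sum>c<Suc ?n. adj_mat (?R z) $$ (?n, c) * gegC (alph k) ((m @ [i]) ! c) z)" for z
  proof -
    have 1: "adj_mat (?R z) \<in> carrier_mat (Suc ?n) (Suc ?n)"
      using adj_mat(1)[OF Rmat_carrier[of k "m @ [i]" "ts @ [0]" z]] by simp
    show ?thesis unfolding gegCm_def Qvec_def
      by (subst mult_mat_vec_sum[OF 1]) (auto intro!: sum.cong)
  qed
  moreover have "polyfun (\<lambda>z. \<Sum>c<Suc ?n. adj_mat (?R z) $$ (?n, c) * gegC (alph k) ((m @ [i]) ! c) z)"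
    by (intro polyfun_intros polyfun_adj_mat[where n = "Suc ?n"])
       (use Rmat_carrier[of k "m @ [i]" "ts @ [0]"] in \<open>auto intro!: polyfun_Rmat\<close>)
  ultimately show ?thesis by (simp add: polyfun_def)
qed

text \<open>The wanted entry comes from the last row \<open>y\<close> of the adjugate of the
  bordered matrix S, which satisfies y S = det(S) e with e the last unit vector. The index
  \<open>i\<close> may itself belong to \<open>m\<close>.\<close>

lemma gegCm_cramer:
  assumes m: "distinct m" and tau: "tau_m k m (map t m) z \<noteq> 0"
  shows "gegCm k m (map t m) i z + (\<Sum>b\<in>set m. geg_rho k i b z * t b * cramer k m t (\<lambda>i. gegC (alph k) i z) z b)
     = tau_m k m (map t m) z * gegC (alph k) i z"
proof -
  let ?n = "length m" and ?R = "Rmat k m (map t m) z" and ?C = "\<lambda>i. gegC (alph k) i z"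
  let ?S = "Rmat k (m @ [i]) (map t m @ [0]) z"
  let ?Q = "cramer k m t ?C z" and ?t = "tau_m k m (map t m) z"
  have S: "?S \<in> carrier_mat (Suc ?n) (Suc ?n)" using Rmat_carrier[of k "m @ [i]"] by simp
  have Sd: "dim_row ?S = Suc ?n" "dim_col ?S = Suc ?n" using S by auto
  have S1: "?S $$ (a, b) = ?R $$ (a, b)" if "a < ?n" "b < ?n" for a b
    using that by (simp add: Rmat_def nth_append)
  have S2: "?S $$ (?n, b) = t (m ! b) * geg_rho k i (m ! b) z" if "b < ?n" for b
    using that by (simp add: Rmat_def nth_append)
  \<comment> \<open>The appended parameter 0 makes the last column a unit vector; the other columns
    then give closed equations for the first entries of \<open>y\<close>.\<close>
  have S3: "?S $$ (a, ?n) = (if a = ?n then 1 else 0)" if "a \<le> ?n" for a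
    using that by (simp add: Rmat_def nth_append)
  define y where "y c = adj_mat ?S $$ (?n, c)" for c
  have yS: "(\<Sum>c<Suc ?n. y c * ?S $$ (c, b)) = (if b = ?n then Determinant.det ?S else 0)" if "b < Suc ?n" for b
  proof -
    have "(\<Sum>c<Suc ?n. y c * ?S $$ (c, b)) = (adj_mat ?S * ?S) $$ (?n, b)"
      using adj_mat(1)[OF S] Sd that by (simp add: scalar_prod_def atLeast0LessThan y_def)
    then show ?thesis unfolding adj_mat(3)[OF S] using that by simp
  qed
  have del: "mat_delete ?S ?n ?n = ?R"
    by (rule eq_matI) (use Sd in \<open>auto simp: mat_delete_def Rmat_def nth_append\<close>)
  have yn: "y ?n = ?t"
    using Sd by (simp add: y_def adj_mat_def cofactor_def del tau_m_def)
  have yb: "(\<Sum>c<?n. y c * ?R $$ (c, b)) = - (?t * t (m ! b) * geg_rho k i (m ! b) z)" if "b < ?n" for b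
    using yS[of b] that by (simp add: S1 S2 yn)
  have "gegCm k m (map t m) i z = (\<Sum>c<?n. y c * ?C (m ! c)) + ?t * ?C i"
    unfolding gegCm_def Qvec_def using adj_mat(1)[OF S]
    by (subst mult_mat_vec_sum[of _ "Suc ?n" "Suc ?n"]) (auto simp: y_def[symmetric] yn nth_append)
  \<comment> \<open>Writing \<tau> C as R applied to the Cramer vector lets the known product y R
    enter; the factor \<tau> is cancelled afterwards.\<close>
  moreover have t: "?t * (\<Sum>c<?n. y c * ?C (m ! c)) = ?t * - (\<Sum>b\<in>set m. geg_rho k i b z * t b * ?Q b)"
  proof -
    have RQ: "(\<Sum>b<?n. ?R $$ (c, b) * ?Q (m ! b)) = ?t * ?C (m ! c)" if "c < ?n" for c
    proof -
      have "(\<Sum>b<?n. ?R $$ (c, b) * ?Q (m ! b)) = (\<Sum>b<?n. (if b = c then ?Q (m ! c) else 0)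
           + geg_rho k (m ! c) (m ! b) z * t (m ! b) * ?Q (m ! b))"
        by (rule sum.cong) (use that in \<open>auto simp: Rmat_index algebra_simps\<close>)
      then show ?thesis using cramer_solves[OF m, of "m ! c" k t ?C z] that
        by (simp add: sum.distrib sum_set_nth[OF m])
    qed
    have "?t * (\<Sum>c<?n. y c * ?C (m ! c)) = (\<Sum>c<?n. y c * (\<Sum>b<?n. ?R $$ (c, b) * ?Q (m ! b)))"
      by (simp add: RQ sum_distrib_left mult_ac)
    also have "\<dots> = (\<Sum>b<?n. (\<Sum>c<?n. y c * ?R $$ (c, b)) * ?Q (m ! b))"
      unfolding sum_distrib_left sum_distrib_right by (subst sum.swap) (simp add: mult_ac)
    also have "\<dots> = ?t * - (\<Sum>b\<in>set m. geg_rho k i b z * t b * ?Q b)"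
      by (simp add: yb sum_set_nth[OF m] sum_distrib_left sum_negf mult_ac)
    finally show ?thesis .
  qed
  then have "(\<Sum>c<?n. y c * ?C (m ! c)) = - (\<Sum>b\<in>set m. geg_rho k i b z * t b * ?Q b)"
    unfolding mult_left_cancel[OF tau] .
  ultimately show ?thesis by simp
qed

lemma gegCm_eq_cramer:
  assumes m: "distinct m" and tau: "tau_m k m (map t m) z \<noteq> 0" and i: "i \<in> set m"
  shows "gegCm k m (map t m) i z = cramer k m t (\<lambda>i. gegC (alph k) i z) z i"
  using gegCm_cramer[OF m tau, of i] cramer_solves[OF m i, of k t "\<lambda>i. gegC (alph k) i z" z] by simp

section \<open>The transformed functions and their differential equation\<close>

locale geg_transform =
  fixes k :: nat and m :: "nat list" and t :: "nat \<Rightarrow> real"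
  assumes m: "distinct m"
begin

abbreviation "C \<equiv> gegC (alph k)"
abbreviation "W \<equiv> gegW k"
abbreviation "\<rho> \<equiv> geg_rho k"
abbreviation "\<tau> \<equiv> tau_m k m (map t m)"
abbreviation "ev i \<equiv> real i * (real i + 2 * alph k)"

text \<open>The operator I + \<rho> T with a free index: for \<open>i\<close> outside
  \<open>m\<close> the equation gives \<open>y i\<close> explicitly from the values on
  \<open>m\<close>.\<close>

definition lin :: "real \<Rightarrow> (nat \<Rightarrow> real) \<Rightarrow> nat \<Rightarrow> real" where
  "lin z y i = y i + (\<Sum>b\<in>set m. \<rho> i b z * t b * y b)"

definition pair :: "(nat \<Rightarrow> real) \<Rightarrow> (nat \<Rightarrow> real) \<Rightarrow> real" where
  "pair x y = (\<Sum>b\<in>set m. t b * x b * y b)"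

lemma lin_add: "lin z (\<lambda>i. x i + y i) i = lin z x i + lin z y i"
  by (simp add: lin_def algebra_simps sum.distrib)

lemma lin_diff: "lin z (\<lambda>i. x i - y i) i = lin z x i - lin z y i"
  by (simp add: lin_def algebra_simps sum_subtractf)

lemma lin_cmult: "lin z (\<lambda>i. c * x i) i = c * lin z x i"
  by (simp add: lin_def algebra_simps sum_distrib_left)

lemma pair_commute: "pair x y = pair y x"
  by (simp add: pair_def mult_ac)

lemma pair_diff: "pair x (\<lambda>i. y i - c * z i) = pair x y - c * pair x z"
  by (simp add: pair_def algebra_simps sum_subtractf sum_distrib_left)

text \<open>Self-adjointness: t b \<rho> b c t c is symmetric in b and c.\<close>

lemma pair_lin: "pair x (lin z y) = pair (lin z x) y"
proof -
  have "(\<Sum>b\<in>set m. \<Sum>c\<in>set m. t b * x b * (\<rho> b c z * t c * y c))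
      = (\<Sum>b\<in>set m. \<Sum>c\<in>set m. t b * (\<rho> b c z * t c * x c) * y b)"
    by (subst sum.swap) (simp add: geg_rho_commute[of k] mult_ac)
  then show ?thesis
    by (simp add: pair_def lin_def distrib_left distrib_right sum.distrib sum_distrib_left sum_distrib_right)
qed

lemma tau_eq_0_iff: "\<tau> z = 0 \<longleftrightarrow> (\<exists>y. (\<exists>i\<in>set m. y i \<noteq> 0) \<and> (\<forall>i\<in>set m. lin z y i = 0))"
  unfolding tau_m_eq_0_iff[OF m] lin_def ..

text \<open>On \<open>m\<close> the kernel is trivial because \<tau> is nonzero; for any other index
  the sum then disappears and leaves \<open>y i\<close> alone.\<close>

lemma lin_eq_0D:
  assumes "\<tau> z \<noteq> 0" "\<And>i. lin z y i = 0"
  shows "y i = 0"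
proof -
  have 0: "y b = 0" if "b \<in> set m" for b
    using assms that unfolding tau_eq_0_iff by blast
  show ?thesis using assms(2)[of i] by (simp add: lin_def 0)
qed

lemma lin_cancel:
  assumes "\<tau> z \<noteq> 0" "\<And>i. lin z x i = lin z y i"
  shows "x i = y i"
  using lin_eq_0D[OF assms(1), of "\<lambda>i. x i - y i" i] by (simp add: lin_diff assms(2))

definition tauP :: "real poly" where "tauP = (SOME p. \<forall>z. \<tau> z = poly p z)"

definition gegP :: "nat \<Rightarrow> real poly" where
  "gegP i = (SOME p. \<forall>z. gegCm k m (map t m) i z = poly p z)"

lemma poly_tauP [simp]: "poly tauP z = \<tau> z"
  unfolding tauP_def
  by (rule sym, rule spec[OF someI_ex[OF polyfun_tau_m[of k m "map t m", unfolded polyfun_def]]])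

lemma poly_gegP [simp]: "poly (gegP i) z = gegCm k m (map t m) i z"
  unfolding gegP_def
  by (rule sym, rule spec[OF someI_ex[OF polyfun_gegCm[of k m "map t m" i, unfolded polyfun_def]]])

lemma tau_eq_poly: "\<tau> = poly tauP"
  by (simp add: fun_eq_iff)

lemma open_tau_nonzero: "open {z. \<tau> z \<noteq> 0}"
  unfolding tau_eq_poly by (intro open_Collect_neq continuous_intros)

definition f :: "nat \<Rightarrow> real \<Rightarrow> real" where
  "f i z = gegCm k m (map t m) i z / \<tau> z"

text \<open>Logarithmic derivative of \<tau>. The next definitions are quotient-rule forms of its
  derivative and of the derivatives of \<open>f i\<close>, arranged so that they can be solved for
  the derivatives of \<open>tauP\<close> and \<open>gegP i\<close>.\<close>

definition \<sigma> :: "real \<Rightarrow> real" where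
  "\<sigma> z = poly (pderiv tauP) z / \<tau> z"

definition \<sigma>1 :: "real \<Rightarrow> real" where
  "\<sigma>1 z = poly (pderiv (pderiv tauP)) z / \<tau> z - (\<sigma> z)\<^sup>2"

definition f1 :: "nat \<Rightarrow> real \<Rightarrow> real" where
  "f1 i z = poly (pderiv (gegP i)) z / \<tau> z - \<sigma> z * f i z"

definition f2 :: "nat \<Rightarrow> real \<Rightarrow> real" where
  "f2 i z = poly (pderiv (pderiv (gegP i))) z / \<tau> z - poly (pderiv (pderiv tauP)) z / \<tau> z * f i z - 2 * \<sigma> z * f1 i z"

lemma DERIV_tau: "(\<tau> has_real_derivative poly (pderiv tauP) z) (at z)"
  unfolding tau_eq_poly by (rule poly_DERIV)

lemma DERIV_\<sigma>:
  assumes "\<tau> z \<noteq> 0"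
  shows "(\<sigma> has_real_derivative \<sigma>1 z) (at z)"
  unfolding \<sigma>_def[abs_def]
  by (rule DERIV_cong[OF DERIV_divide[OF poly_DERIV DERIV_tau assms]])
     (use assms in \<open>simp add: \<sigma>1_def \<sigma>_def field_simps power2_eq_square\<close>)

lemma DERIV_f:
  assumes "\<tau> z \<noteq> 0"
  shows "(f i has_real_derivative f1 i z) (at z)"
proof -
  have "f i = (\<lambda>z. poly (gegP i) z / \<tau> z)" by (simp add: f_def fun_eq_iff)
  moreover have "((\<lambda>z. poly (gegP i) z / \<tau> z) has_real_derivative f1 i z) (at z)"
    by (rule DERIV_cong[OF DERIV_divide[OF poly_DERIV DERIV_tau assms]])
       (use assms in \<open>simp add: f1_def \<sigma>_def f_def field_simps power2_eq_square\<close>)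
  ultimately show ?thesis by simp
qed

lemma DERIV_f1:
  assumes "\<tau> z \<noteq> 0"
  shows "(f1 i has_real_derivative f2 i z) (at z)"
  unfolding f1_def[abs_def]
  by (rule DERIV_cong[OF DERIV_diff[OF DERIV_divide[OF poly_DERIV DERIV_tau assms]
        DERIV_mult[OF DERIV_\<sigma>[OF assms] DERIV_f[OF assms]]]])
     (use assms in \<open>simp add: f2_def f1_def \<sigma>1_def \<sigma>_def f_def field_simps power2_eq_square\<close>)

lemma cramer_f:
  assumes "\<tau> z \<noteq> 0" "b \<in> set m"
  shows "cramer k m t (\<lambda>i. C i z) z b = \<tau> z * f b z"
  using gegCm_eq_cramer[OF m assms] assms by (simp add: f_def)

lemma lin_f:
  assumes z: "\<tau> z \<noteq> 0"
  shows "lin z (\<lambda>i. f i z) i = C i z"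
proof -
  have "\<tau> z * lin z (\<lambda>i. f i z) i = \<tau> z * f i z + (\<Sum>b\<in>set m. \<rho> i b z * t b * (\<tau> z * f b z))"
    by (simp add: lin_def distrib_left sum_distrib_left mult_ac)
  also have "\<dots> = gegCm k m (map t m) i z + (\<Sum>b\<in>set m. \<rho> i b z * t b * cramer k m t (\<lambda>i. C i z) z b)"
    using z by (simp add: cramer_f[OF z]) (simp add: f_def)
  also have "\<dots> = \<tau> z * C i z" by (rule gegCm_cramer[OF m z])
  finally show ?thesis using z by simp
qed

lemma lin_f_fun: "\<tau> z \<noteq> 0 \<Longrightarrow> lin z (\<lambda>i. f i z) = (\<lambda>i. C i z)"
  by (rule ext) (rule lin_f)

lemma \<sigma>_eq:
  assumes z: "\<tau> z \<noteq> 0"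
  shows "\<sigma> z = W z * pair (\<lambda>b. C b z) (\<lambda>b. f b z)"
proof -
  have "poly (pderiv tauP) z = W z * (\<Sum>b\<in>set m. t b * C b z * cramer k m t (\<lambda>i. C i z) z b)"
    by (rule DERIV_unique[OF DERIV_tau DERIV_tau_m[OF m]])
  also have "\<dots> = \<tau> z * (W z * pair (\<lambda>b. C b z) (\<lambda>b. f b z))"
    by (simp add: cramer_f[OF z] pair_def sum_distrib_left mult_ac)
  finally show ?thesis using z by (simp add: \<sigma>_def)
qed

text \<open>Differentiating \<rho> i b gives W C i C b, so the extra term is a multiple of the one
  vector \<open>C\<close>. The derivative is taken within a set because completeness uses one-sided
  derivatives at the endpoints.\<close>

lemma DERIV_lin:
  assumes "\<And>b. ((\<lambda>z. y z b) has_real_derivative y' b) (at z within S)"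
  shows "((\<lambda>z. lin z (y z) i) has_real_derivative
           lin z y' i + W z * C i z * pair (\<lambda>b. C b z) (y z)) (at z within S)"
proof -
  have "((\<lambda>z. lin z (y z) i) has_real_derivative
      y' i + (\<Sum>b\<in>set m. (C i z * C b z * W z * t b) * y z b + y' b * (\<rho> i b z * t b))) (at z within S)"
    unfolding lin_def
    by (intro DERIV_add DERIV_sum DERIV_mult DERIV_cmult_right
          has_field_derivative_at_within[OF DERIV_geg_rho] assms)
  then show ?thesis
    by (rule DERIV_cong) (simp add: lin_def pair_def sum.distrib sum_distrib_left mult_ac)
qed

text \<open>Implicit differentiation of a system that holds on the open set where \<tau> is
  nonzero.\<close>

lemma lin_deriv:
  assumes z: "\<tau> z \<noteq> 0"
    and y: "\<And>b. ((\<lambda>z. y z b) has_real_derivative y' b) (at z)"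
    and x: "((\<lambda>z. x z) has_real_derivative x') (at z)"
    and eq: "\<And>z. \<tau> z \<noteq> 0 \<Longrightarrow> lin z (y z) i = x z"
  shows "lin z y' i = x' - W z * C i z * pair (\<lambda>b. C b z) (y z)"
proof -
  have "(x has_real_derivative lin z y' i + W z * C i z * pair (\<lambda>b. C b z) (y z)) (at z)"
    by (rule has_field_derivative_transform_within_open[OF DERIV_lin[OF y] open_tau_nonzero])
       (use z eq in auto)
  from DERIV_unique[OF this x] show ?thesis by simp
qed

section \<open>The differential equation of the transformed functions\<close>

lemma lin_f1:
  assumes z: "\<tau> z \<noteq> 0"
  shows "lin z (\<lambda>i. f1 i z) i = gegC1 k i z - \<sigma> z * C i z"
  using lin_deriv[OF z DERIV_f[OF z] DERIV_gegC lin_f] by (simp add: \<sigma>_eq[OF z] mult_ac)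

text \<open>The derivative of \<open>gegP i\<close> divided by \<tau>. The added term cancels the
  correction in \<open>lin_f1\<close>, so \<open>g\<close> solves the system with right-hand side
  C'.\<close>

definition g :: "nat \<Rightarrow> real \<Rightarrow> real" where
  "g i z = f1 i z + \<sigma> z * f i z"

definition g1 :: "nat \<Rightarrow> real \<Rightarrow> real" where
  "g1 i z = f2 i z + \<sigma>1 z * f i z + \<sigma> z * f1 i z"

lemma DERIV_g: "\<tau> z \<noteq> 0 \<Longrightarrow> (g i has_real_derivative g1 i z) (at z)"
  unfolding g_def[abs_def] g1_def
  by (rule DERIV_cong[OF DERIV_add[OF DERIV_f1 DERIV_mult[OF DERIV_\<sigma> DERIV_f]]]) (auto simp: mult_ac)

lemma lin_g:
  assumes z: "\<tau> z \<noteq> 0"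
  shows "lin z (\<lambda>i. g i z) i = gegC1 k i z"
  by (simp add: g_def lin_add lin_cmult lin_f1[OF z] lin_f[OF z])

definition \<kappa> :: "real \<Rightarrow> real" where
  "\<kappa> z = pair (\<lambda>b. C b z) (\<lambda>b. g b z)"

text \<open>Self-adjointness turns the pairing of \<open>C\<close> with \<open>g\<close> into that
  of C' with \<open>f\<close>. The first arises from differentiating the system, the second from the
  Wronskian formula; their equality lets the two corrections combine.\<close>

lemma \<kappa>_eq:
  assumes z: "\<tau> z \<noteq> 0"
  shows "\<kappa> z = pair (\<lambda>b. gegC1 k b z) (\<lambda>b. f b z)"
proof -
  have "\<kappa> z = pair (lin z (\<lambda>i. f i z)) (\<lambda>b. g b z)" by (simp add: \<kappa>_def lin_f_fun[OF z])
  also have "\<dots> = pair (\<lambda>b. f b z) (lin z (\<lambda>b. g b z))" by (rule pair_lin[symmetric])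
  also have "lin z (\<lambda>b. g b z) = (\<lambda>b. gegC1 k b z)" by (rule ext) (rule lin_g[OF z])
  finally show ?thesis by (simp add: pair_commute)
qed

lemma lin_g1:
  assumes z: "\<tau> z \<noteq> 0"
  shows "lin z (\<lambda>i. g1 i z) i = gegC2 k i z - W z * C i z * \<kappa> z"
  using lin_deriv[OF z DERIV_g[OF z] DERIV_gegC1 lin_g] by (simp add: \<kappa>_def)

text \<open>By the Wronskian formula the commutator of diag(ev) with \<rho> has only two terms, one
  along C' and one along C; their coefficients are \<sigma> and \<kappa>.\<close>

lemma lin_ev_f:
  assumes z: "\<tau> z \<noteq> 0"
  shows "lin z (\<lambda>i. ev i * f i z) i
     = ev i * C i z + (1 - z\<^sup>2) * (gegC1 k i z * \<sigma> z - W z * C i z * \<kappa> z)"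
proof -
  have "lin z (\<lambda>i. ev i * f i z) i
      = ev i * lin z (\<lambda>i. f i z) i + (\<Sum>b\<in>set m. ((ev b - ev i) * \<rho> i b z) * t b * f b z)"
    unfolding lin_def distrib_left sum_distrib_left add.assoc sum.distrib[symmetric]
    by (simp add: algebra_simps)
  also have "(\<Sum>b\<in>set m. ((ev b - ev i) * \<rho> i b z) * t b * f b z)
      = (1 - z\<^sup>2) * W z * (\<Sum>b\<in>set m. gegC1 k i z * (t b * C b z * f b z) - C i z * (t b * gegC1 k b z * f b z))"
    unfolding geg_rho_wronskian sum_distrib_left
    by (intro sum.cong) (auto simp: algebra_simps)
  also have "\<dots> = (1 - z\<^sup>2) * W z * (gegC1 k i z * pair (\<lambda>b. C b z) (\<lambda>b. f b z) - C i z * \<kappa> z)"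
    unfolding \<kappa>_eq[OF z] pair_def sum_subtractf sum_distrib_left ..
  finally show ?thesis by (simp add: lin_f[OF z] \<sigma>_eq[OF z] algebra_simps)
qed

text \<open>By uniqueness it suffices to apply \<open>lin z\<close>, after which only the classical
  equation is needed. Of the 2 before \<kappa>, one unit comes from \<open>lin_g1\<close> and one
  compensates \<open>lin_ev_f\<close>.\<close>

lemma g1_eq:
  assumes z: "\<tau> z \<noteq> 0"
  shows "(1 - z\<^sup>2) * g1 i z = (2 * alph k + 1) * z * g i z - ev i * f i z
      + (1 - z\<^sup>2) * \<sigma> z * g i z - 2 * (1 - z\<^sup>2) * W z * \<kappa> z * f i z"
proof (rule lin_cancel[OF z, where x = "\<lambda>i. (1 - z\<^sup>2) * g1 i z"])
  fix i
  show "lin z (\<lambda>i. (1 - z\<^sup>2) * g1 i z) i = lin z (\<lambda>i. (2 * alph k + 1) * z * g i z - ev i * f i z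
      + (1 - z\<^sup>2) * \<sigma> z * g i z - 2 * (1 - z\<^sup>2) * W z * \<kappa> z * f i z) i"
    unfolding lin_diff lin_add lin_ev_f[OF z] lin_cmult lin_f[OF z] lin_g[OF z] lin_g1[OF z] right_diff_distrib gegC_ode
    by (simp add: algebra_simps)
qed

text \<open>Differentiate \<open>\<sigma>_eq\<close>: C' and f' = g - \<sigma> f contribute one
  \<kappa> each, and the weight enters through its Pearson equation.\<close>

lemma \<sigma>1_eq:
  assumes z: "\<tau> z \<noteq> 0"
  shows "(1 - z\<^sup>2) * \<sigma>1 z = - 2 * real k * z * \<sigma> z + 2 * (1 - z\<^sup>2) * W z * \<kappa> z - (1 - z\<^sup>2) * (\<sigma> z)\<^sup>2"
proof -
  let ?s = "\<lambda>z. pair (\<lambda>b. C b z) (\<lambda>b. f b z)"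
  obtain w where w: "(W has_real_derivative w) (at z)" "(1 - z\<^sup>2) * w = - 2 * real k * z * W z"
    using DERIV_gegW by blast
  have "(?s has_real_derivative (\<Sum>b\<in>set m. (t b * gegC1 k b z) * f b z + f1 b z * (t b * C b z))) (at z)"
    unfolding pair_def by (intro DERIV_sum DERIV_mult DERIV_cmult DERIV_gegC DERIV_f z)
  moreover have "(\<Sum>b\<in>set m. (t b * gegC1 k b z) * f b z + f1 b z * (t b * C b z))
      = \<kappa> z + pair (\<lambda>b. C b z) (\<lambda>b. f1 b z)"
    unfolding \<kappa>_eq[OF z] pair_def sum.distrib by (simp add: mult_ac)
  moreover have "(\<lambda>b. f1 b z) = (\<lambda>b. g b z - \<sigma> z * f b z)" by (simp add: g_def)
  ultimately have s: "(?s has_real_derivative (2 * \<kappa> z - \<sigma> z * ?s z)) (at z)"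
    by (simp add: pair_diff \<kappa>_def)
  have "((\<lambda>z. W z * ?s z) has_real_derivative (w * ?s z + (2 * \<kappa> z - \<sigma> z * ?s z) * W z)) (at z)"
    by (rule DERIV_mult[OF w(1) s])
  then have "(\<sigma> has_real_derivative (w * ?s z + (2 * \<kappa> z - \<sigma> z * ?s z) * W z)) (at z)"
    by (rule has_field_derivative_transform_within_open[OF _ open_tau_nonzero]) (use z \<sigma>_eq in auto)
  from DERIV_unique[OF DERIV_\<sigma>[OF z] this]
  have "\<sigma>1 z = w * ?s z + 2 * \<kappa> z * W z - (\<sigma> z)\<^sup>2"
    using \<sigma>_eq[OF z] by (simp add: algebra_simps power2_eq_square)
  then have "(1 - z\<^sup>2) * \<sigma>1 z = (1 - z\<^sup>2) * (w * ?s z + 2 * \<kappa> z * W z - (\<sigma> z)\<^sup>2)"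
    by (rule arg_cong)
  then have "(1 - z\<^sup>2) * \<sigma>1 z = ((1 - z\<^sup>2) * w) * ?s z + (1 - z\<^sup>2) * (2 * \<kappa> z * W z - (\<sigma> z)\<^sup>2)"
    by (simp add: algebra_simps)
  then show ?thesis unfolding w(2) using \<sigma>_eq[OF z] by (simp add: algebra_simps)
qed

text \<open>Expressing \<kappa> through \<sigma>1 removes the last unknown scalar. The term 2
  \<sigma>1 is twice the second logarithmic derivative of \<tau>, the usual Darboux change of
  potential.\<close>

lemma f_ode:
  assumes z: "\<tau> z \<noteq> 0"
  shows "(1 - z\<^sup>2) * (f2 i z + 2 * \<sigma>1 z * f i z) - (2 * alph k + 1) * z * f1 i z - 2 * z * \<sigma> z * f i z
     = - ev i * f i z"
proof -
  have k: "real k = alph k - 1/2" by (simp add: alph_def)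
  have 1: "(1 - z\<^sup>2) * f2 i z = (1 - z\<^sup>2) * g1 i z - (1 - z\<^sup>2) * \<sigma>1 z * f i z - (1 - z\<^sup>2) * \<sigma> z * f1 i z"
    by (simp add: g1_def algebra_simps)
  have 2: "2 * (1 - z\<^sup>2) * W z * \<kappa> z = (1 - z\<^sup>2) * \<sigma>1 z + 2 * real k * z * \<sigma> z + (1 - z\<^sup>2) * (\<sigma> z)\<^sup>2"
    unfolding \<sigma>1_eq[OF z] by simp
  have "(1 - z\<^sup>2) * f2 i z = (2 * alph k + 1) * z * g i z - ev i * f i z
      + (1 - z\<^sup>2) * \<sigma> z * g i z - ((1 - z\<^sup>2) * \<sigma>1 z + 2 * real k * z * \<sigma> z + (1 - z\<^sup>2) * (\<sigma> z)\<^sup>2) * f i z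
      - (1 - z\<^sup>2) * \<sigma>1 z * f i z - (1 - z\<^sup>2) * \<sigma> z * f1 i z"
    unfolding 1 g1_eq[OF z] 2[symmetric] ..
  then show ?thesis unfolding g_def k distrib_left
    by (simp add: algebra_simps power2_eq_square)
qed

text \<open>\<open>T_op\<close> is the operator of \<open>f_ode\<close> conjugated by multiplication
  with \<tau>.\<close>

lemma T_op_gegP:
  assumes z: "\<tau> z \<noteq> 0"
  shows "T_op (alph k) tauP (gegP i) z = - ev i * poly (gegP i) z"
proof -
  have P: "poly (gegP i) z = \<tau> z * f i z" using z by (simp add: f_def)
  have P1: "poly (pderiv (gegP i)) z = \<tau> z * (f1 i z + \<sigma> z * f i z)"
    using z by (simp add: f1_def)
  have T: "poly (pderiv (pderiv tauP)) z / \<tau> z = \<sigma>1 z + (\<sigma> z)\<^sup>2" by (simp add: \<sigma>1_def)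
  have P2: "poly (pderiv (pderiv (gegP i))) z = \<tau> z * (f2 i z + (\<sigma>1 z + (\<sigma> z)\<^sup>2) * f i z + 2 * \<sigma> z * f1 i z)"
    using z by (simp add: f2_def T)
  have "T_op (alph k) tauP (gegP i) z = \<tau> z * ((1 - z\<^sup>2) * (f2 i z + 2 * \<sigma>1 z * f i z)
      - (2 * alph k + 1) * z * f1 i z - 2 * z * \<sigma> z * f i z)"
    unfolding T_op_def P P1 P2 poly_tauP T \<sigma>_def[symmetric]
    by (simp add: algebra_simps power2_eq_square)
  also have "\<dots> = \<tau> z * (- ev i * f i z)" unfolding f_ode[OF z] ..
  finally show ?thesis unfolding P by simp
qed

text \<open>For fixed \<open>j\<close> the column \<open>\<rho> i j\<close> is transformed just like
  the column \<open>C i\<close>. Its derivative becomes a product because self-adjointness evaluates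
  the pairing of \<open>C\<close> with \<open>H\<close> as C j - f j.\<close>

lemma gram_exists:
  obtains H where
    "\<And>z i. \<tau> z \<noteq> 0 \<Longrightarrow> lin z (H z) i = \<rho> i j z"
    "\<And>z i. \<tau> z \<noteq> 0 \<Longrightarrow> ((\<lambda>z. H z i) has_real_derivative W z * f j z * f i z) (at z)"
proof -
  define h where "h z b = cramer k m t (\<lambda>i. \<rho> i j z) z b" for z b
  \<comment> \<open>Where \<tau> is nonzero this is \<open>h z i / \<tau> z\<close> for members of
    \<open>m\<close>; the formula extends the solution to all indices.\<close>
  define H where "H z i = \<rho> i j z - (\<Sum>b\<in>set m. \<rho> i b z * t b * h z b) / \<tau> z" for z i
  have Hh: "H z b = h z b / \<tau> z" if "b \<in> set m" "\<tau> z \<noteq> 0" for b z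
    using cramer_solves[OF m that(1), of k t "\<lambda>i. \<rho> i j z" z] that(2)
    by (simp add: H_def h_def field_simps)
  have lin: "lin z (H z) i = \<rho> i j z" if z: "\<tau> z \<noteq> 0" for z i
  proof -
    have "(\<Sum>b\<in>set m. \<rho> i b z * t b * H z b) = (\<Sum>b\<in>set m. \<rho> i b z * t b * h z b) / \<tau> z"
      by (simp add: Hh z sum_divide_distrib)
    then show ?thesis by (simp add: lin_def) (simp add: H_def)
  qed
  have D: "\<exists>d. ((\<lambda>z. H z i) has_real_derivative d) (at z)" if z: "\<tau> z \<noteq> 0" for z i
  proof -
    have "polyfun (\<lambda>z. \<Sum>b\<in>set m. \<rho> i b z * t b * h z b)"
      unfolding h_def by (intro polyfun_intros polyfun_cramer m)
    then obtain p where p: "\<And>z. (\<Sum>b\<in>set m. \<rho> i b z * t b * h z b) = poly p z"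
      unfolding polyfun_def by blast
    show ?thesis unfolding H_def p
      by (rule exI) (rule DERIV_diff[OF DERIV_geg_rho DERIV_divide[OF poly_DERIV DERIV_tau z]])
  qed
  show thesis
  proof (rule that[OF lin])
    fix z i assume z: "\<tau> z \<noteq> 0"
    obtain d where d: "\<And>i. ((\<lambda>z. H z i) has_real_derivative d i) (at z)" using D[OF z] by metis
    have "pair (\<lambda>b. C b z) (H z) = pair (lin z (\<lambda>b. f b z)) (H z)"
      by (simp add: lin_f_fun[OF z])
    also have "\<dots> = pair (\<lambda>b. f b z) (lin z (H z))" by (rule pair_lin[symmetric])
    also have "lin z (H z) = (\<lambda>i. \<rho> i j z)" by (rule ext) (rule lin[OF z])
    also have "pair (\<lambda>b. f b z) (\<lambda>i. \<rho> i j z) = (\<Sum>b\<in>set m. \<rho> j b z * t b * f b z)"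
      unfolding pair_def by (intro sum.cong) (auto simp: geg_rho_commute[of k _ j] mult_ac)
    also have "\<dots> = C j z - f j z" using lin_f[OF z, of j] by (simp add: lin_def)
    finally have pr: "pair (\<lambda>b. C b z) (H z) = C j z - f j z" .
    have "lin z d i = lin z (\<lambda>i. W z * f j z * f i z) i" for i
      using lin_deriv[OF z d DERIV_geg_rho lin] unfolding pr lin_cmult lin_f[OF z] by (simp add: algebra_simps)
    from lin_cancel[OF z this] show "((\<lambda>z. H z i) has_real_derivative W z * f j z * f i z) (at z)"
      using d by metis
  qed
qed

end

section \<open>Density of continuous functions in weighted square means\<close>

text \<open>A measurable function is almost everywhere a limit of continuous ones. Clipping these to
  [-B, B] keeps both properties and provides a constant majorant for dominated convergence.\<close>

lemma continuous_dense_bounded: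
  fixes \<Phi> w :: "real \<Rightarrow> real"
  assumes [measurable]: "\<Phi> \<in> borel_measurable borel" "w \<in> borel_measurable borel"
    and B: "\<And>x. \<bar>\<Phi> x\<bar> \<le> B"
    and w: "\<And>x. x \<in> {a..b} \<Longrightarrow> 0 \<le> w x \<and> w x \<le> 1"
    and e: "e > 0"
  obtains h where "continuous_on UNIV h"
    "(\<integral>\<^sup>+ x \<in> {a..b}. ennreal ((\<Phi> x - h x)\<^sup>2 * w x) \<partial>lborel) < ennreal e"
proof -
  have "\<Phi> \<in> borel_measurable (lebesgue_on UNIV)"
    by (intro measurable_restrict_space1 measurable_completion) simp
  then have "\<Phi> measurable_on UNIV" by (subst measurable_on_iff_borel_measurable) auto
  then obtain N g where N: "negligible N" and g: "\<And>n. continuous_on UNIV (g n)"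
    and lim: "\<And>x. x \<notin> N \<Longrightarrow> (\<lambda>n. g n x) \<longlonglongrightarrow> \<Phi> x"
    unfolding measurable_on_def by auto
  define h where "h n x = max (- B) (min B (g n x))" for n :: nat and x :: real
  have hc: "continuous_on UNIV (h n)" for n
    unfolding h_def by (intro continuous_intros g)
  have [measurable]: "h n \<in> borel_measurable borel" for n
    by (rule borel_measurable_continuous_onI[OF hc])
  have hB: "\<bar>h n x\<bar> \<le> B" for n x using B[of x] by (auto simp: h_def)
  have hlim: "(\<lambda>n. h n x) \<longlonglongrightarrow> \<Phi> x" if "x \<notin> N" for x
  proof -
    have "(\<lambda>n. h n x) \<longlonglongrightarrow> max (- B) (min B (\<Phi> x))"
      unfolding h_def by (intro tendsto_intros lim that)
    then show ?thesis using B[of x] by (simp add: abs_le_iff max_def min_def split: if_splits)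
  qed
  have "(\<lambda>n. \<integral>\<^sup>+ x \<in> {a..b}. ennreal ((\<Phi> x - h n x)\<^sup>2 * w x) \<partial>lborel)
      \<longlonglongrightarrow> (\<integral>\<^sup>+ (x::real). 0 \<partial>lborel)"
  proof (rule nn_integral_dominated_convergence[where w = "\<lambda>x. ennreal ((2 * B)\<^sup>2) * indicator {a..b} x"])
    fix n
    show "AE x in lborel. ennreal ((\<Phi> x - h n x)\<^sup>2 * w x) * indicator {a..b} x
        \<le> ennreal ((2 * B)\<^sup>2) * indicator {a..b} x"
    proof (rule AE_I2)
      fix x
      have "\<bar>\<Phi> x - h n x\<bar> \<le> 2 * B" using B[of x] hB[of n x] by linarith
      then have *: "(\<Phi> x - h n x)\<^sup>2 \<le> (2 * B)\<^sup>2" by (rule abs_le_square_iff[THEN iffD1, OF order_trans]) simp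
      have "(\<Phi> x - h n x)\<^sup>2 * w x \<le> (2 * B)\<^sup>2 * 1" if "x \<in> {a..b}"
        using w[OF that] * by (intro mult_mono) auto
      then show "ennreal ((\<Phi> x - h n x)\<^sup>2 * w x) * indicator {a..b} x
        \<le> ennreal ((2 * B)\<^sup>2) * indicator {a..b} x"
        by (auto simp: indicator_def intro!: ennreal_leI)
    qed
  next
    show "(\<integral>\<^sup>+ x. ennreal ((2 * B)\<^sup>2) * indicator {a..b} x \<partial>lborel) < \<infinity>"
      by (subst nn_integral_cmult_indicator) (auto simp: ennreal_mult_less_top emeasure_lborel_Icc_eq)
  next
    have "AE x in lborel. x \<notin> N"
    proof -
      have "N \<in> null_sets lebesgue" using N negligible_iff_null_sets by blast
      then have "AE x in lebesgue. x \<notin> N" by (rule AE_not_in)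
      then show ?thesis by (simp only: AE_completion_iff)
    qed
    then show "AE x in lborel. (\<lambda>n. ennreal ((\<Phi> x - h n x)\<^sup>2 * w x) * indicator {a..b} x) \<longlonglongrightarrow> 0"
    proof (rule AE_mp, intro AE_I2 impI)
      fix x assume "x \<notin> N"
      have "(\<lambda>n. (\<Phi> x - h n x)\<^sup>2 * w x) \<longlonglongrightarrow> (\<Phi> x - \<Phi> x)\<^sup>2 * w x"
        by (intro tendsto_intros hlim \<open>x \<notin> N\<close>)
      from tendsto_ennrealI[OF this]
      have "(\<lambda>n. ennreal ((\<Phi> x - h n x)\<^sup>2 * w x)) \<longlonglongrightarrow> 0" by simp
      then show "(\<lambda>n. ennreal ((\<Phi> x - h n x)\<^sup>2 * w x) * indicator {a..b} x) \<longlonglongrightarrow> 0"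
        by (cases "x \<in> {a..b}") auto
    qed
  qed measurable
  then have "eventually (\<lambda>n. (\<integral>\<^sup>+ x \<in> {a..b}. ennreal ((\<Phi> x - h n x)\<^sup>2 * w x) \<partial>lborel) < ennreal e) sequentially"
    using e by (intro order_tendstoD(2)) auto
  then show thesis using that hc by (auto simp: eventually_sequentially)
qed

lemma square_diff_le: "(x - z)\<^sup>2 \<le> 2 * (x - y)\<^sup>2 + 2 * (y - z)\<^sup>2" for x y z :: real
proof -
  have "2 * (x - y)\<^sup>2 + 2 * (y - z)\<^sup>2 - (x - z)\<^sup>2 = (x - 2 * y + z)\<^sup>2"
    by (simp add: power2_eq_square algebra_simps)
  then show ?thesis using zero_le_power2[of "x - 2 * y + z"] by linarith
qed

lemma nn_integral_square_triangle:
  fixes \<phi> \<psi> \<theta> w :: "real \<Rightarrow> real"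
  assumes [measurable]: "\<phi> \<in> borel_measurable borel" "\<psi> \<in> borel_measurable borel" "\<theta> \<in> borel_measurable borel"
     "w \<in> borel_measurable borel"
    and w: "\<And>x. x \<in> {a..b} \<Longrightarrow> 0 \<le> w x"
  shows "(\<integral>\<^sup>+ x \<in> {a..b}. ennreal ((\<phi> x - \<theta> x)\<^sup>2 * w x) \<partial>lborel)
     \<le> 2 * (\<integral>\<^sup>+ x \<in> {a..b}. ennreal ((\<phi> x - \<psi> x)\<^sup>2 * w x) \<partial>lborel)
       + 2 * (\<integral>\<^sup>+ x \<in> {a..b}. ennreal ((\<psi> x - \<theta> x)\<^sup>2 * w x) \<partial>lborel)"
proof -
  have "(\<integral>\<^sup>+ x \<in> {a..b}. ennreal ((\<phi> x - \<theta> x)\<^sup>2 * w x) \<partial>lborel)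
     \<le> (\<integral>\<^sup>+ x. 2 * (ennreal ((\<phi> x - \<psi> x)\<^sup>2 * w x) * indicator {a..b} x)
          + 2 * (ennreal ((\<psi> x - \<theta> x)\<^sup>2 * w x) * indicator {a..b} x) \<partial>lborel)"
  proof (rule nn_integral_mono)
    fix x :: real
    show "ennreal ((\<phi> x - \<theta> x)\<^sup>2 * w x) * indicator {a..b} x
       \<le> 2 * (ennreal ((\<phi> x - \<psi> x)\<^sup>2 * w x) * indicator {a..b} x)
          + 2 * (ennreal ((\<psi> x - \<theta> x)\<^sup>2 * w x) * indicator {a..b} x)"
    proof (cases "x \<in> {a..b}")
      case True
      have "(\<phi> x - \<theta> x)\<^sup>2 * w x \<le> (2 * (\<phi> x - \<psi> x)\<^sup>2 + 2 * (\<psi> x - \<theta> x)\<^sup>2) * w x"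
        by (intro mult_right_mono square_diff_le w True)
      also have "\<dots> = 2 * ((\<phi> x - \<psi> x)\<^sup>2 * w x) + 2 * ((\<psi> x - \<theta> x)\<^sup>2 * w x)"
        by (simp add: algebra_simps)
      finally have "ennreal ((\<phi> x - \<theta> x)\<^sup>2 * w x)
          \<le> ennreal (2 * ((\<phi> x - \<psi> x)\<^sup>2 * w x) + 2 * ((\<psi> x - \<theta> x)\<^sup>2 * w x))"
        by (rule ennreal_leI)
      also have "\<dots> = 2 * ennreal ((\<phi> x - \<psi> x)\<^sup>2 * w x) + 2 * ennreal ((\<psi> x - \<theta> x)\<^sup>2 * w x)"
        using w[OF True] by (subst ennreal_plus) (auto simp: ennreal_mult)
      finally show ?thesis using True by simp
    qed simp
  qed
  also have "\<dots> = 2 * (\<integral>\<^sup>+ x \<in> {a..b}. ennreal ((\<phi> x - \<psi> x)\<^sup>2 * w x) \<partial>lborel)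
       + 2 * (\<integral>\<^sup>+ x \<in> {a..b}. ennreal ((\<psi> x - \<theta> x)\<^sup>2 * w x) \<partial>lborel)"
    by (subst nn_integral_add) (auto simp: nn_integral_cmult)
  finally show ?thesis .
qed

lemma two_ennreal_less:
  assumes "I < ennreal e" "J < ennreal e" "e \<ge> 0"
  shows "2 * I + 2 * J < ennreal (4 * e)"
proof -
  obtain i where i: "I = ennreal i" "i \<ge> 0" using assms(1) by (cases I) auto
  obtain j where j: "J = ennreal j" "j \<ge> 0" using assms(2) by (cases J) auto
  have "i < e" "j < e" using assms i j by (auto simp: ennreal_less_iff)
  have "2 * I + 2 * J = ennreal (2 * i + 2 * j)" using i j by (simp add: ennreal_mult)
  also have "\<dots> < ennreal (4 * e)" using \<open>i < e\<close> \<open>j < e\<close> i j by (intro ennreal_lessI) auto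
  finally show ?thesis .
qed

text \<open>Truncation at height \<open>n\<close> reduces to bounded functions; the truncation error
  is dominated by the given integrable square.\<close>

lemma continuous_dense_L2:
  fixes \<Phi> w :: "real \<Rightarrow> real"
  assumes [measurable]: "\<Phi> \<in> borel_measurable borel" "w \<in> borel_measurable borel"
    and fin: "(\<integral>\<^sup>+ x \<in> {a..b}. ennreal ((\<Phi> x)\<^sup>2 * w x) \<partial>lborel) < \<infinity>"
    and w: "\<And>x. x \<in> {a..b} \<Longrightarrow> 0 \<le> w x \<and> w x \<le> 1"
    and e: "e > 0"
  obtains h where "continuous_on UNIV h"
    "(\<integral>\<^sup>+ x \<in> {a..b}. ennreal ((\<Phi> x - h x)\<^sup>2 * w x) \<partial>lborel) < ennreal e"
proof -
  define T where "T n x = max (- real n) (min (real n) (\<Phi> x))" for n :: nat and x :: real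
  have [measurable]: "T n \<in> borel_measurable borel" for n unfolding T_def by measurable
  have TB: "\<bar>T n x\<bar> \<le> real n" for n x by (auto simp: T_def)
  have Tle: "\<bar>\<Phi> x - T n x\<bar> \<le> \<bar>\<Phi> x\<bar>" for n x by (auto simp: T_def)
  have Tlim: "(\<lambda>n. T n x) \<longlonglongrightarrow> \<Phi> x" for x
  proof (rule tendsto_eventually)
    obtain N where "\<bar>\<Phi> x\<bar> \<le> real N" using real_arch_simple by blast
    then have "T n x = \<Phi> x" if "n \<ge> N" for n
      using that by (auto simp: T_def abs_le_iff max_def min_def)
    then show "eventually (\<lambda>n. T n x = \<Phi> x) sequentially" by (auto simp: eventually_sequentially)
  qed
  have "(\<lambda>n. \<integral>\<^sup>+ x \<in> {a..b}. ennreal ((\<Phi> x - T n x)\<^sup>2 * w x) \<partial>lborel)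
      \<longlonglongrightarrow> (\<integral>\<^sup>+ (x::real). 0 \<partial>lborel)"
  proof (rule nn_integral_dominated_convergence[where w = "\<lambda>x. ennreal ((\<Phi> x)\<^sup>2 * w x) * indicator {a..b} x"])
    fix n
    show "AE x in lborel. ennreal ((\<Phi> x - T n x)\<^sup>2 * w x) * indicator {a..b} x
        \<le> ennreal ((\<Phi> x)\<^sup>2 * w x) * indicator {a..b} x"
    proof (rule AE_I2)
      fix x
      have "(\<Phi> x - T n x)\<^sup>2 \<le> (\<Phi> x)\<^sup>2" using Tle[of x n] by (simp add: abs_le_square_iff)
      then have "(\<Phi> x - T n x)\<^sup>2 * w x \<le> (\<Phi> x)\<^sup>2 * w x" if "x \<in> {a..b}"
        using w[OF that] by (intro mult_right_mono) auto
      then show "ennreal ((\<Phi> x - T n x)\<^sup>2 * w x) * indicator {a..b} x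
        \<le> ennreal ((\<Phi> x)\<^sup>2 * w x) * indicator {a..b} x"
        by (auto simp: indicator_def intro!: ennreal_leI)
    qed
  next
    show "AE x in lborel. (\<lambda>n. ennreal ((\<Phi> x - T n x)\<^sup>2 * w x) * indicator {a..b} x) \<longlonglongrightarrow> 0"
    proof (rule AE_I2)
      fix x
      have "(\<lambda>n. (\<Phi> x - T n x)\<^sup>2 * w x) \<longlonglongrightarrow> (\<Phi> x - \<Phi> x)\<^sup>2 * w x"
        by (intro tendsto_intros Tlim)
      from tendsto_ennrealI[OF this]
      have "(\<lambda>n. ennreal ((\<Phi> x - T n x)\<^sup>2 * w x)) \<longlonglongrightarrow> 0" by simp
      then show "(\<lambda>n. ennreal ((\<Phi> x - T n x)\<^sup>2 * w x) * indicator {a..b} x) \<longlonglongrightarrow> 0"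
        by (cases "x \<in> {a..b}") auto
    qed
  qed (use fin in \<open>measurable\<close>)
  \<comment> \<open>The triangle estimate doubles each of two errors, hence a quarter of
    \<open>e\<close> for each.\<close>
  then have "eventually (\<lambda>n. (\<integral>\<^sup>+ x \<in> {a..b}. ennreal ((\<Phi> x - T n x)\<^sup>2 * w x) \<partial>lborel) < ennreal (e / 4)) sequentially"
    using e by (intro order_tendstoD(2)) auto
  then obtain n where n: "(\<integral>\<^sup>+ x \<in> {a..b}. ennreal ((\<Phi> x - T n x)\<^sup>2 * w x) \<partial>lborel) < ennreal (e / 4)"
    by (auto simp: eventually_sequentially)
  obtain h where h: "continuous_on UNIV h"
    "(\<integral>\<^sup>+ x \<in> {a..b}. ennreal ((T n x - h x)\<^sup>2 * w x) \<partial>lborel) < ennreal (e / 4)"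
    using continuous_dense_bounded[of "T n" w "real n" a b "e / 4"] TB w e by auto
  have [measurable]: "h \<in> borel_measurable borel"
    by (rule borel_measurable_continuous_onI[OF h(1)])
  have "(\<integral>\<^sup>+ x \<in> {a..b}. ennreal ((\<Phi> x - h x)\<^sup>2 * w x) \<partial>lborel)
     \<le> 2 * (\<integral>\<^sup>+ x \<in> {a..b}. ennreal ((\<Phi> x - T n x)\<^sup>2 * w x) \<partial>lborel)
       + 2 * (\<integral>\<^sup>+ x \<in> {a..b}. ennreal ((T n x - h x)\<^sup>2 * w x) \<partial>lborel)"
    by (rule nn_integral_square_triangle) (use w in auto)
  also have "\<dots> < ennreal (4 * (e / 4))"
    using e by (intro two_ennreal_less n h(2)) auto
  finally show thesis using that h(1) by simp
qed

section \<open>Norms, degrees and completeness\<close>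

text \<open>The increment is the integral over [x, y] of W times the square of \<Sum> e a C a, and W
  is nonnegative on [-1,1].\<close>

lemma weighted_quadratic_form_mono:
  assumes "finite M" "x \<le> y" "{x..y} \<subseteq> {-1..1}"
  shows "(\<Sum>a\<in>M. \<Sum>b\<in>M. e a * e b * geg_rho k a b x) \<le> (\<Sum>a\<in>M. \<Sum>b\<in>M. e a * e b * geg_rho k a b y)"
proof -
  have "((\<lambda>u. \<Sum>a\<in>M. \<Sum>b\<in>M. e a * e b * (gegC (alph k) a u * gegC (alph k) b u * gegW k u))
      has_integral (\<Sum>a\<in>M. \<Sum>b\<in>M. e a * e b * (geg_rho k a b y - geg_rho k a b x))) {x..y}"
    by (intro has_integral_sum has_integral_mult_right geg_rho_has_integral assms)
  moreover have "(\<Sum>a\<in>M. \<Sum>b\<in>M. e a * e b * (gegC (alph k) a u * gegC (alph k) b u * gegW k u)) \<ge> 0"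
    if u: "u \<in> {x..y}" for u
  proof -
    have "(\<Sum>a\<in>M. \<Sum>b\<in>M. e a * e b * (gegC (alph k) a u * gegC (alph k) b u * gegW k u))
        = (\<Sum>a\<in>M. e a * gegC (alph k) a u)\<^sup>2 * gegW k u"
      by (simp add: power2_eq_square sum_product sum_distrib_right sum_distrib_left mult_ac)
    moreover have "u\<^sup>2 \<le> 1" using u assms(3) by (auto simp: abs_square_le_1 abs_le_iff)
    ultimately show ?thesis by (simp add: gegW_def)
  qed
  ultimately have "0 \<le> (\<Sum>a\<in>M. \<Sum>b\<in>M. e a * e b * (geg_rho k a b y - geg_rho k a b x))"
    by (rule has_integral_nonneg)
  then show ?thesis by (simp add: right_diff_distrib sum_subtractf)
qed

lemma gegW_bounds: "z \<in> {-1..1} \<Longrightarrow> 0 \<le> gegW k z \<and> gegW k z \<le> 1"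
proof -
  assume "z \<in> {-1..1}"
  then have "z\<^sup>2 \<le> 1" by (auto simp: abs_square_le_1 abs_le_iff)
  then show ?thesis by (simp add: gegW_def power_le_one)
qed

lemma polyfun_gegC_expansion:
  assumes a: "a > 0"
  shows "\<exists>c. \<forall>z. poly p z = (\<Sum>i\<le>degree p. c i * gegC a i z)"
proof (induction "degree p" arbitrary: p rule: less_induct)
  case less
  let ?d = "degree p" and ?G = "geg_poly a (degree p)"
  define c where "c = coeff p ?d / coeff ?G ?d"
  have cd: "coeff ?G ?d \<noteq> 0" by (rule coeff_geg_poly_top_nonzero[OF a])
  define q where "q = p - Polynomial.smult c ?G"
  have pq: "poly p z = poly q z + c * gegC a ?d z" for z by (simp add: q_def)
  have qd: "degree q \<le> ?d"
    unfolding q_def by (intro degree_diff_le degree_geg_poly_le order_trans[OF degree_smult_le]) auto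
  have q0: "coeff q ?d = 0" using cd by (simp add: q_def c_def)
  show ?case
  proof (cases "?d = 0")
    \<comment> \<open>In degree 0 the remainder is zero itself and no smaller degree is left for the
      induction.\<close>
    case True
    then have "q = 0" using qd q0 by (metis le_zero_eq leading_coeff_0_iff)
    then show ?thesis using True by (intro exI[of _ "\<lambda>_. c"]) (simp add: pq)
  next
    case False
    have "degree q < ?d"
      using qd q0 False by (metis eq_zero_or_degree_less gr0I degree_0)
    then obtain e where e: "\<And>z. poly q z = (\<Sum>i\<le>degree q. e i * gegC a i z)" using less by blast
    have "poly p z = (\<Sum>i\<le>?d. (if i = ?d then c else if i \<le> degree q then e i else 0) * gegC a i z)" for z
    proof -
      have "(\<Sum>i\<le>?d. (if i = ?d then c else if i \<le> degree q then e i else 0) * gegC a i z)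
        = c * gegC a ?d z + (\<Sum>i\<in>{..?d} - {?d}. (if i = ?d then c else if i \<le> degree q then e i else 0) * gegC a i z)"
        by (subst sum.remove[of _ ?d]) auto
      also have "(\<Sum>i\<in>{..?d} - {?d}. (if i = ?d then c else if i \<le> degree q then e i else 0) * gegC a i z)
         = (\<Sum>i\<le>degree q. e i * gegC a i z)"
        by (rule sum.mono_neutral_cong_right) (use \<open>degree q < ?d\<close> in auto)
      finally show ?thesis by (simp add: pq e)
    qed
    then show ?thesis by (intro exI allI)
  qed
qed

lemma polynomial_approximation:
  fixes f :: "real \<Rightarrow> real"
  assumes "continuous_on {a..b} f" "e > 0"
  obtains p where "\<And>x. x \<in> {a..b} \<Longrightarrow> \<bar>f x - poly p x\<bar> < e"
proof -
  have "\<exists>g. polyfun g \<and> (\<forall>x\<in>{a..b}. \<bar>f x - g x\<bar> < e)"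
  proof (rule Stone_Weierstrass_HOL)
    show "continuous_on {a..b} f" if "polyfun f" for f
      using that by (auto simp: polyfun_def intro!: continuous_intros cong: continuous_on_cong)
    show "\<exists>f. polyfun f \<and> f x \<noteq> f y" if "x \<in> {a..b} \<and> y \<in> {a..b} \<and> x \<noteq> y" for x y
      using that by (intro exI[of _ "poly [:0, 1:]"]) (auto intro: polyfun_intros)
  qed (use assms in \<open>auto intro: polyfun_intros\<close>)
  then obtain g p where "\<forall>x\<in>{a..b}. \<bar>f x - g x\<bar> < e" "\<forall>z. g z = poly p z"
    unfolding polyfun_def by blast
  then show thesis by (intro that[of p]) auto
qed

text \<open>Here \<open>p\<close> and \<open>q\<close> are mere degree bounds, so that factors whose
  top coefficient vanishes, such as derivatives of constants, are covered.\<close>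

lemma coeff_mult_top:
  fixes A B :: "real poly"
  assumes "degree A \<le> p" "degree B \<le> q"
  shows "coeff (A * B) (p + q) = coeff A p * coeff B q"
proof -
  have "coeff (A * B) (p + q) = (\<Sum>i\<le>p + q. if i = p then coeff A p * coeff B q else 0)"
    unfolding coeff_mult
  proof (rule sum.cong[OF refl])
    fix i assume "i \<in> {..p + q}"
    then consider "i = p" | "degree A < i" | "degree B < p + q - i" using assms by force
    then show "coeff A i * coeff B (p + q - i) = (if i = p then coeff A p * coeff B q else 0)"
    proof cases
      case 2
      then show ?thesis using assms by (auto simp: coeff_eq_0)
    next
      case 3
      then show ?thesis using assms by (auto simp: coeff_eq_0)
    qed simp
  qed
  then show ?thesis by simp
qed

text \<open>The eigenvalue is read off the leading coefficients: with \<open>D = degree \<tau>\<close> and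
  \<open>d = degree p\<close>, it is the classical Gegenbauer eigenvalue at the integer \<open>d - D\<close>.\<close>

lemma T_op_eigenvalue_degree:
  fixes \<tau> p :: "real poly"
  assumes "\<tau> \<noteq> 0" "p \<noteq> 0"
    and eig: "\<And>z. poly \<tau> z \<noteq> 0 \<Longrightarrow> T_op a \<tau> p z = ev * poly p z"
  shows "(real (degree p) - real (degree \<tau>)) * (real (degree p) - real (degree \<tau>) + 2 * a) = - ev"
proof -
  let ?D = "degree \<tau>" and ?d = "degree p"
  \<comment> \<open>\<open>\<theta>\<close> and \<open>\<delta>\<close> are z d/dz and z^2 d^2/dz^2:
    diagonal on monomials, so they never raise the degree.\<close>
  define \<theta> where "\<theta> q = pCons 0 (pderiv q)" for q :: "real poly"
  define \<delta> where "\<delta> q = pCons 0 (pCons 0 (pderiv (pderiv q)))" for q :: "real poly"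
  have c1: "coeff (\<theta> q) n = real n * coeff q n" for q n
    by (cases n) (auto simp: \<theta>_def coeff_pderiv)
  have c2: "coeff (\<delta> q) n = real n * (real n - 1) * coeff q n" for q n
    by (cases n; cases "n - 1") (auto simp: \<delta>_def coeff_pderiv)
  have d1: "degree (\<theta> q) \<le> degree q" for q by (rule degree_le) (auto simp: c1 coeff_eq_0)
  have d2: "degree (\<delta> q) \<le> degree q" for q by (rule degree_le) (auto simp: c2 coeff_eq_0)
  have p1: "poly (\<theta> q) z = z * poly (pderiv q) z" for q z by (simp add: \<theta>_def)
  have p2: "poly (\<delta> q) z = z * (z * poly (pderiv (pderiv q)) z)" for q z by (simp add: \<delta>_def)
  \<comment> \<open>Multiplied by z^2 \<tau>, the eigenvalue equation reads Y = z^2 Z. Since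
    \<open>Y\<close> has degree at most D + d, the coefficient of \<open>Z\<close> at D + d
    vanishes.\<close>
  define Y where "Y = \<tau> * \<delta> p - Polynomial.smult 2 (\<theta> \<tau> * \<theta> p) + \<delta> \<tau> * p"
  define Z where "Z = Y + Polynomial.smult (2 * a + 1) (\<tau> * \<theta> p)
      - Polynomial.smult (2 * a - 1) (\<theta> \<tau> * p) + Polynomial.smult ev (\<tau> * p)"
  \<comment> \<open>The extra factor \<tau> takes care of its zeros, where \<open>eig\<close> says
    nothing.\<close>
  have "poly (\<tau> * (Y - pCons 0 (pCons 0 Z))) z = 0" for z
  proof (cases "poly \<tau> z = 0")
    case False
    have "poly (Y - pCons 0 (pCons 0 Z)) z = z * z * (poly \<tau> z * (T_op a \<tau> p z - ev * poly p z))"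
      using False by (simp add: Y_def Z_def p1 p2 T_op_def power2_eq_square field_simps)
    then show ?thesis using eig[OF False] by simp
  qed simp
  then have "\<tau> * (Y - pCons 0 (pCons 0 Z)) = 0" using poly_all_0_iff_0 by blast
  then have YZ: "Y = pCons 0 (pCons 0 Z)" using assms(1) by simp
  note deg = degree_mult_le[THEN order_trans, OF add_mono, of _ ?D _ ?d]
  have "degree Y \<le> ?D + ?d"
    unfolding Y_def by (intro degree_add_le degree_diff_le order_trans[OF degree_smult_le] deg d1 d2 order_refl)
  then have "coeff Y (Suc (Suc (?D + ?d))) = 0" by (simp add: coeff_eq_0)
  then have Z0: "coeff Z (?D + ?d) = 0" unfolding YZ by simp
  have "(real ?d * (real ?d - 1) - 2 * real ?D * real ?d + real ?D * (real ?D - 1)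
      + (2 * a + 1) * real ?d - (2 * a - 1) * real ?D + ev) * (coeff \<tau> ?D * coeff p ?d) = coeff Z (?D + ?d)"
    unfolding Z_def Y_def
    by (simp add: coeff_mult_top d1 d2 c1 c2) (simp add: algebra_simps)
  moreover have "coeff \<tau> ?D * coeff p ?d \<noteq> 0" using assms by simp
  ultimately have "real ?d * (real ?d - 1) - 2 * real ?D * real ?d + real ?D * (real ?D - 1)
      + (2 * a + 1) * real ?d - (2 * a - 1) * real ?D + ev = 0" unfolding Z0 by (simp only: mult_eq_0_iff) blast
  then show ?thesis by (simp add: algebra_simps)
qed

section \<open>Norms and the condition on the parameters\<close>

context geg_transform
begin

abbreviation "\<nu> \<equiv> geg_nu (alph k)"

text \<open>Orthogonality makes \<rho> diagonal at 1, so the system decouples there.\<close>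

lemma lin_at_1: "lin 1 y i = y i + (if i \<in> set m then \<nu> i * t i * y i else 0)"
proof -
  have "(\<Sum>b\<in>set m. \<rho> i b 1 * t b * y b) = (\<Sum>b\<in>set m. if b = i then \<nu> i * t i * y i else 0)"
    by (rule sum.cong) (auto simp: geg_rho_1_offdiag geg_rho_1_diag)
  then show ?thesis by (simp add: lin_def)
qed

lemma lin_at_minus_1: "lin (-1) y i = y i"
  by (simp add: lin_def)

text \<open>The norm is H 1 i - H (-1) i. It is stated as a product because this form itself forces
  the factor to be nonzero and, as N is nonnegative, positive.\<close>

lemma f_norm:
  assumes nz: "\<And>z. z \<in> {-1..1} \<Longrightarrow> \<tau> z \<noteq> 0"
  obtains N where "((\<lambda>u. W u * (f i u)\<^sup>2) has_integral N) {-1..1}"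
    "N * (1 + (if i \<in> set m then 1 else 0) * t i * \<nu> i) = \<nu> i"
proof -
  obtain H where H: "\<And>z j. \<tau> z \<noteq> 0 \<Longrightarrow> lin z (H z) j = \<rho> j i z"
    "\<And>z j. \<tau> z \<noteq> 0 \<Longrightarrow> ((\<lambda>z. H z j) has_real_derivative W z * f i z * f j z) (at z)"
    using gram_exists by metis
  have "((\<lambda>u. W u * f i u * f i u) has_integral H 1 i - H (-1) i) {-1..1}"
    by (rule fundamental_theorem_of_calculus)
       (auto simp flip: has_real_derivative_iff_has_vector_derivative
          intro!: has_field_derivative_at_within H(2) nz)
  moreover have "H (-1) i = 0" using H(1)[of "-1" i] nz[of "-1"] by (simp add: lin_at_minus_1)
  ultimately have "((\<lambda>u. W u * (f i u)\<^sup>2) has_integral H 1 i) {-1..1}"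
    by (simp add: power2_eq_square mult.assoc)
  moreover have "H 1 i * (1 + (if i \<in> set m then 1 else 0) * t i * \<nu> i) = \<nu> i"
    using H(1)[of 1 i] nz[of 1] by (auto simp: lin_at_1 geg_rho_1_diag algebra_simps)
  ultimately show thesis by (rule that)
qed

lemma gt_minus_inverse_iff: "t i > - inverse (\<nu> i) \<longleftrightarrow> 1 + t i * \<nu> i > 0"
  using geg_nu_pos[of k i] by (simp add: field_simps) linarith

lemma nonvanishing_imp_parameters:
  assumes nz: "\<And>z. z \<in> {-1..1} \<Longrightarrow> \<tau> z \<noteq> 0" and i: "i \<in> set m"
  shows "t i > - inverse (\<nu> i)"
proof -
  obtain N where N: "((\<lambda>u. W u * (f i u)\<^sup>2) has_integral N) {-1..1}" "N * (1 + t i * \<nu> i) = \<nu> i"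
    using f_norm[OF nz, of i] i by (auto simp: mult_ac)
  have "N \<ge> 0" by (rule has_integral_nonneg[OF N(1)]) (use gegW_bounds in auto)
  then show ?thesis
    unfolding gt_minus_inverse_iff using N(2) geg_nu_pos[of k i] by (metis zero_less_mult_pos mult_zero_left less_irrefl order_le_less)
qed

text \<open>A kernel vector of \<open>I + \<rho> T\<close> at \<open>z\<close> would contradict Bessel's inequality for the
  restriction of \<open>\<Sum>b. t b * y b * C b\<close> to \<open>[-1, z]\<close>.\<close>

lemma parameters_imp_nonvanishing:
  assumes t: "\<And>i. i \<in> set m \<Longrightarrow> t i > - inverse (\<nu> i)" and z: "z \<in> {-1..1}"
  shows "\<tau> z \<noteq> 0"
proof
  assume "\<tau> z = 0"
  then obtain y where ne: "\<exists>i\<in>set m. y i \<noteq> 0" and ker: "\<And>i. i \<in> set m \<Longrightarrow> lin z y i = 0"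
    unfolding tau_eq_0_iff by blast
  define c where "c b = t b * y b" for b
  \<comment> \<open>By the kernel equation, \<open>- y b\<close> is the inner product on [-1, z] of
    \<Sum> c a C a with \<open>C b\<close>; so \<open>d\<close> lists the Fourier coefficients on
    [-1, 1] of that function cut off at z.\<close>
  define d where "d b = - y b / \<nu> b" for b
  define Q where "Q e e' x = (\<Sum>a\<in>set m. \<Sum>b\<in>set m. e a * e' b * \<rho> a b x)" for e e' x
  have rc: "(\<Sum>b\<in>set m. \<rho> a b z * c b) = - y a" if "a \<in> set m" for a
    using ker[OF that] by (simp add: lin_def c_def mult.assoc)
  have Qc: "Q e c z = (\<Sum>a\<in>set m. - (e a * y a))" for e
    unfolding Q_def using rc by (intro sum.cong refl) (simp add: mult.assoc mult.left_commute sum_distrib_left[symmetric] mult.commute[of "c _"])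
  have Qsym: "Q c d z = Q d c z"
    unfolding Q_def by (subst sum.swap) (simp add: geg_rho_commute[of k] mult_ac)
  \<comment> \<open>Each mixed term is \<Sum> y^2/\<nu>, the \<open>c\<close> term is - \<Sum> t
    y^2, and the \<open>d\<close> term is at most its value at 1, again \<Sum> y^2/\<nu>.
    Nonnegativity thus yields \<Sum> (t + 1/\<nu>) y^2 \<le> 0.\<close>
  have "Q (\<lambda>b. c b - d b) (\<lambda>b. c b - d b) z = Q c c z - Q d c z - Q c d z + Q d d z"
    unfolding Q_def by (simp add: algebra_simps sum.distrib sum_subtractf)
  moreover have "0 \<le> Q (\<lambda>b. c b - d b) (\<lambda>b. c b - d b) z"
    using weighted_quadratic_form_mono[of "set m" "-1" z "\<lambda>b. c b - d b" k] z by (simp add: Q_def)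
  moreover have "Q d d z \<le> Q d d 1"
    using weighted_quadratic_form_mono[of "set m" z 1 d k] z by (simp add: Q_def)
  moreover have "Q d d 1 = (\<Sum>a\<in>set m. (y a)\<^sup>2 / \<nu> a)"
    unfolding Q_def
  proof (rule sum.cong[OF refl])
    fix a assume a: "a \<in> set m"
    have "(\<Sum>b\<in>set m. d a * d b * \<rho> a b 1) = (\<Sum>b\<in>set m. if b = a then d a * d a * \<nu> a else 0)"
      by (rule sum.cong) (auto simp: geg_rho_1_offdiag geg_rho_1_diag)
    also have "\<dots> = (y a)\<^sup>2 / \<nu> a"
      using a geg_nu_pos[of k a] by (simp add: d_def power2_eq_square)
    finally show "(\<Sum>b\<in>set m. d a * d b * \<rho> a b 1) = (y a)\<^sup>2 / \<nu> a" .
  qed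
  moreover have "Q d c z = (\<Sum>a\<in>set m. (y a)\<^sup>2 / \<nu> a)"
    unfolding Qc by (intro sum.cong) (auto simp: d_def power2_eq_square)
  moreover have "Q c c z = - (\<Sum>a\<in>set m. t a * (y a)\<^sup>2)"
    unfolding Qc by (simp add: c_def power2_eq_square sum_negf mult_ac)
  ultimately have le: "(\<Sum>a\<in>set m. t a * (y a)\<^sup>2) + (\<Sum>a\<in>set m. (y a)\<^sup>2 / \<nu> a) \<le> 0"
    using Qsym by linarith
  have pos: "t a + inverse (\<nu> a) > 0" if "a \<in> set m" for a using t[OF that] by linarith
  have "(\<Sum>a\<in>set m. (t a + inverse (\<nu> a)) * (y a)\<^sup>2) \<le> 0"
    using le unfolding distrib_right sum.distrib by (simp add: divide_inverse mult.commute)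
  moreover have "(t a + inverse (\<nu> a)) * (y a)\<^sup>2 \<ge> 0" if "a \<in> set m" for a
    using pos[OF that] by (intro mult_nonneg_nonneg) auto
  ultimately have "\<forall>a\<in>set m. (t a + inverse (\<nu> a)) * (y a)\<^sup>2 = 0"
    by (subst sum_nonneg_eq_0_iff[symmetric]) (auto intro: antisym sum_nonneg)
  then show False using ne pos by (metis mult_eq_0_iff less_irrefl power2_eq_iff_nonneg power_eq_0_iff)
qed

section \<open>Completeness\<close>

lemma continuous_on_f:
  assumes "\<And>z. z \<in> S \<Longrightarrow> \<tau> z \<noteq> 0"
  shows "continuous_on S (f i)"
  using DERIV_f[OF assms] by (meson DERIV_isCont continuous_at_imp_continuous_on)

text \<open>The map \<open>G \<mapsto> G - \<Sum>a. (\<integral> G C a W) t a f a\<close> sends \<open>C i\<close> to \<open>f i\<close>; it is inverted by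
  \<open>h \<mapsto> h + \<Sum>a. t a (\<integral> h f a W) C a\<close>.\<close>

lemma transform_onto_continuous:
  assumes nz: "\<And>z. z \<in> {-1..1} \<Longrightarrow> \<tau> z \<noteq> 0" and h: "continuous_on {-1..1} h"
  obtains G e where "continuous_on {-1..1} G"
    "\<And>a z. z \<in> {-1..1} \<Longrightarrow> ((\<lambda>u. G u * C a u * W u) has_integral e a z) {-1..z}"
    "\<And>z. z \<in> {-1..1} \<Longrightarrow> h z = G z - (\<Sum>a\<in>set m. e a z * (t a * f a z))"
proof -
  define H where "H z a = integral {-1..z} (\<lambda>u. h u * f a u * W u)" for z a
  have cont: "continuous_on {-1..1} (\<lambda>u. h u * f a u * W u)" for a
    by (intro continuous_intros h continuous_on_f nz)
  have H': "((\<lambda>z. H z a) has_real_derivative h z * W z * f a z) (at z within {-1..1})" if "z \<in> {-1..1}" for z a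
    using integral_has_vector_derivative[OF cont that, of a]
    by (simp add: H_def has_real_derivative_iff_has_vector_derivative mult_ac)
  have Hc: "continuous_on {-1..1} (\<lambda>z. H z a)" for a
    using H' by (meson DERIV_continuous continuous_on_eq_continuous_within)
  define G where "G z = h z + pair (\<lambda>a. C a z) (H z)" for z
  have G: "continuous_on {-1..1} G"
    unfolding G_def pair_def by (intro continuous_intros h Hc)
  have int: "((\<lambda>u. G u * C a u * W u) has_integral lin z (H z) a) {-1..z}" if z: "z \<in> {-1..1}" for z a
  proof -
    \<comment> \<open>The extra term of \<open>DERIV_lin\<close> is exactly the pairing added in
      \<open>G\<close>; at -1 both \<rho> and \<open>H\<close> vanish.\<close>
    have "((\<lambda>u. G u * C a u * W u) has_integral lin z (H z) a - lin (-1) (H (-1)) a) {-1..z}"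
    proof (rule fundamental_theorem_of_calculus)
      fix u assume "u \<in> {-1..z}"
      then have u: "u \<in> {-1..1}" using z by auto
      have "((\<lambda>z. lin z (H z) a) has_real_derivative
          lin u (\<lambda>b. h u * W u * f b u) a + W u * C a u * pair (\<lambda>b. C b u) (H u)) (at u within {-1..1})"
        by (rule DERIV_lin) (rule H'[OF u])
      also have "lin u (\<lambda>b. h u * W u * f b u) a + W u * C a u * pair (\<lambda>b. C b u) (H u) = G u * C a u * W u"
        unfolding lin_cmult lin_f[OF nz[OF u]] by (simp add: G_def algebra_simps)
      finally show "((\<lambda>z. lin z (H z) a) has_vector_derivative G u * C a u * W u) (at u within {-1..z})"
        unfolding has_real_derivative_iff_has_vector_derivative[symmetric]
        by (rule DERIV_subset) (use z in auto)
    qed (use z in auto)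
    then show ?thesis by (simp add: lin_at_minus_1) (simp add: H_def)
  qed
  have "h z = G z - (\<Sum>a\<in>set m. lin z (H z) a * (t a * f a z))" if z: "z \<in> {-1..1}" for z
  proof -
    \<comment> \<open>Self-adjointness turns the correction back into the pairing that was added to
      \<open>h\<close>.\<close>
    have "(\<Sum>a\<in>set m. lin z (H z) a * (t a * f a z)) = pair (\<lambda>a. f a z) (lin z (H z))"
      by (simp add: pair_def mult_ac)
    also have "\<dots> = pair (\<lambda>a. C a z) (H z)" unfolding pair_lin lin_f_fun[OF nz[OF z]] ..
    finally show ?thesis by (simp add: G_def)
  qed
  from that[OF G int this] show thesis .
qed

text \<open>The preimage \<open>G\<close> is approximated uniformly by a polynomial, hence by
  classical polynomials; the map to the \<open>f i\<close> enlarges the error at most by the factor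
  \<open>K\<close>.\<close>

lemma f_approximates_continuous:
  assumes nz: "\<And>z. z \<in> {-1..1} \<Longrightarrow> \<tau> z \<noteq> 0" and h: "continuous_on {-1..1} h" and \<eta>: "\<eta> > 0"
  obtains N c where "\<And>z. z \<in> {-1..1} \<Longrightarrow> \<bar>h z - (\<Sum>i<N. c i * f i z)\<bar> \<le> \<eta>"
proof -
  obtain G e where G: "continuous_on {-1..1} G"
    and e: "\<And>a z. z \<in> {-1..1} \<Longrightarrow> ((\<lambda>u. G u * C a u * W u) has_integral e a z) {-1..z}"
    and hG: "\<And>z. z \<in> {-1..1} \<Longrightarrow> h z = G z - (\<Sum>a\<in>set m. e a z * (t a * f a z))"
    using transform_onto_continuous[OF nz h] by blast
  have "\<exists>B. \<forall>u\<in>{-1..1}. \<bar>C a u * W u\<bar> \<le> B" for a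
  proof -
    have "continuous_on {-1..1} (\<lambda>u. C a u * W u)" by (intro continuous_intros)
    from compact_imp_bounded[OF compact_continuous_image[OF this compact_Icc]]
    show ?thesis by (auto simp: bounded_iff)
  qed
  then obtain B where B: "\<And>a u. u \<in> {-1..1} \<Longrightarrow> \<bar>C a u * W u\<bar> \<le> B a" by metis
  have "\<exists>D. \<forall>u\<in>{-1..1}. \<bar>t a * f a u\<bar> \<le> D" for a
  proof -
    have "continuous_on {-1..1} (\<lambda>u. t a * f a u)"
      by (intro continuous_intros continuous_on_f nz)
    from compact_imp_bounded[OF compact_continuous_image[OF this compact_Icc]]
    show ?thesis by (auto simp: bounded_iff)
  qed
  then obtain D where D: "\<And>a u. u \<in> {-1..1} \<Longrightarrow> \<bar>t a * f a u\<bar> \<le> D a" by metis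
  have B0: "B a \<ge> 0" and D0: "D a \<ge> 0" for a
    using B[of 0 a] D[of 0 a] by auto
  \<comment> \<open>The 1 bounds the identity part; each \<open>a\<close> adds interval length 2,
    times the bound \<open>B a\<close> inside the integral, times the bound \<open>D a\<close>
    outside.\<close>
  define K where "K = 1 + (\<Sum>a\<in>set m. 2 * B a * D a)"
  have K: "K > 0" unfolding K_def using B0 D0 by (intro add_pos_nonneg sum_nonneg) auto
  define \<delta> where "\<delta> = \<eta> / K"
  have \<delta>: "\<delta> > 0" using \<eta> K by (simp add: \<delta>_def)
  obtain p where p: "\<And>x. x \<in> {-1..1} \<Longrightarrow> \<bar>G x - poly p x\<bar> < \<delta>"
    using polynomial_approximation[OF G \<delta>] by blast
  obtain c where c: "\<And>z. poly p z = (\<Sum>i\<le>degree p. c i * C i z)"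
    using polyfun_gegC_expansion[OF alph_pos] by blast
  have "\<bar>h z - (\<Sum>i\<le>degree p. c i * f i z)\<bar> \<le> \<eta>" if z: "z \<in> {-1..1}" for z
  proof -
    \<comment> \<open>The integral of \<open>poly p\<close> against \<open>C a\<close> and the
      weight up to z, the counterpart of \<open>e a z\<close>.\<close>
    define r where "r a = (\<Sum>i\<le>degree p. c i * \<rho> i a z)" for a
    have fe: "f i z = C i z - (\<Sum>a\<in>set m. \<rho> i a z * (t a * f a z))" for i
      using lin_f[OF nz[OF z], of i] by (simp add: lin_def mult.assoc)
    have "(\<Sum>i\<le>degree p. c i * f i z) = (\<Sum>i\<le>degree p. c i * (C i z - (\<Sum>a\<in>set m. \<rho> i a z * (t a * f a z))))"
      by (rule sum.cong[OF refl]) (rule arg_cong[OF fe])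
    also have "\<dots> = (\<Sum>i\<le>degree p. c i * C i z) - (\<Sum>i\<le>degree p. \<Sum>a\<in>set m. c i * \<rho> i a z * (t a * f a z))"
      by (simp add: right_diff_distrib sum_subtractf sum_distrib_left mult.assoc)
    also have "(\<Sum>i\<le>degree p. \<Sum>a\<in>set m. c i * \<rho> i a z * (t a * f a z)) = (\<Sum>a\<in>set m. r a * (t a * f a z))"
      unfolding r_def sum_distrib_right by (rule sum.swap)
    finally have "h z - (\<Sum>i\<le>degree p. c i * f i z)
       = (G z - poly p z) - (\<Sum>a\<in>set m. (e a z - r a) * (t a * f a z))"
      unfolding hG[OF z] c[symmetric] by (simp add: left_diff_distrib sum_subtractf)
    moreover have "\<bar>(e a z - r a) * (t a * f a z)\<bar> \<le> \<delta> * (2 * B a * D a)" for a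
    proof -
      have "((\<lambda>u. \<Sum>i\<le>degree p. c i * (C i u * C a u * W u)) has_integral
          (\<Sum>i\<le>degree p. c i * (\<rho> i a z - \<rho> i a (-1)))) {-1..z}"
        by (intro has_integral_sum has_integral_mult_right geg_rho_has_integral) (use z in auto)
      then have "((\<lambda>u. poly p u * C a u * W u) has_integral r a) {-1..z}"
        unfolding c r_def by (simp add: sum_distrib_right mult.assoc)
      from has_integral_diff[OF e[OF z] this]
      have "((\<lambda>u. (G u - poly p u) * (C a u * W u)) has_integral e a z - r a) (cbox (-1) z)"
        by (simp add: algebra_simps)
      then have "norm (e a z - r a) \<le> \<delta> * B a * measure lborel (cbox (-1) z)"
      proof (rule has_integral_bound[rotated])
        fix u assume "u \<in> cbox (-1) z"
        then have u: "u \<in> {-1..1}" using z by auto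
        show "norm ((G u - poly p u) * (C a u * W u)) \<le> \<delta> * B a"
          unfolding real_norm_def abs_mult[of "G u - poly p u"]
          using p[OF u] B[OF u, of a] \<delta> by (intro mult_mono) auto
      qed (use \<delta> B0 in auto)
      also have "\<dots> \<le> \<delta> * B a * 2"
        using z \<delta> B0 by (intro mult_left_mono) auto
      finally have "\<bar>e a z - r a\<bar> \<le> \<delta> * B a * 2" by simp
      then have "\<bar>e a z - r a\<bar> * \<bar>t a * f a z\<bar> \<le> (\<delta> * B a * 2) * D a"
        using D[OF z, of a] \<delta> B0 by (intro mult_mono) auto
      then show ?thesis by (simp add: abs_mult mult_ac)
    qed
    ultimately have "\<bar>h z - (\<Sum>i\<le>degree p. c i * f i z)\<bar> \<le> \<bar>G z - poly p z\<bar> + (\<Sum>a\<in>set m. \<delta> * (2 * B a * D a))"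
      using sum_norm_le[of "set m" "\<lambda>a. (e a z - r a) * (t a * f a z)" "\<lambda>a. \<delta> * (2 * B a * D a)"] by simp
    also have "\<dots> \<le> \<delta> + (\<Sum>a\<in>set m. \<delta> * (2 * B a * D a))" using p[OF z] by simp
    also have "\<dots> = \<delta> * K" by (simp add: K_def distrib_left sum_distrib_left)
    also have "\<dots> = \<eta>" using K by (simp add: \<delta>_def)
    finally show ?thesis .
  qed
  then show thesis using that[of c "Suc (degree p)"] by (simp add: lessThan_Suc_atMost)
qed

text \<open>The endpoints are left out because \<open>0 powr 0\<close> is 0 but \<open>0 ^ 0\<close>
  is 1, so the two sides can differ there when \<open>k = 0\<close>.\<close>

lemma W_tau_eq: "z \<in> {-1<..<1} \<Longrightarrow> W_tau (alph k) tauP z = W z / (\<tau> z)\<^sup>2"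
proof -
  assume "z \<in> {-1<..<1}"
  then have "1 - z\<^sup>2 > 0" by (simp add: abs_square_less_1 abs_less_iff)
  then show ?thesis by (simp add: W_tau_def gegW_def alph_def powr_realpow)
qed

text \<open>Division by \<tau> is an isometry to the space with the classical weight and sends
  \<open>gegP i\<close> to \<open>f i\<close>. There continuous functions are dense, and uniform
  approximation controls the bounded weight.\<close>

lemma complete_gegP:
  assumes nz: "\<And>z. z \<in> {-1..1} \<Longrightarrow> \<tau> z \<noteq> 0"
  shows "complete_L2W (W_tau (alph k) tauP) gegP"
  unfolding complete_L2W_def
proof (intro allI impI)
  fix F :: "real \<Rightarrow> real" and \<epsilon> :: real
  assume F: "in_L2W (W_tau (alph k) tauP) F" and \<epsilon>: "\<epsilon> > 0"
  then have [measurable]: "F \<in> borel_measurable borel" by (simp add: in_L2W_def)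
  have [measurable]: "poly p \<in> borel_measurable borel" for p :: "real poly"
    by (intro borel_measurable_continuous_onI continuous_intros)
  have [measurable]: "\<tau> \<in> borel_measurable borel" unfolding tau_eq_poly by measurable
  have [measurable]: "W \<in> borel_measurable borel"
    by (intro borel_measurable_continuous_onI continuous_intros)
  have norm_eq: "(\<integral>\<^sup>+ x \<in> {-1..1}. ennreal ((\<psi> x)\<^sup>2 * W_tau (alph k) tauP x) \<partial>lborel)
     = (\<integral>\<^sup>+ x \<in> {-1..1}. ennreal ((\<psi> x / \<tau> x)\<^sup>2 * W x) \<partial>lborel)" for \<psi>
  proof (rule nn_integral_cong_AE)
    show "AE x in lborel. ennreal ((\<psi> x)\<^sup>2 * W_tau (alph k) tauP x) * indicator {-1..1} x
       = ennreal ((\<psi> x / \<tau> x)\<^sup>2 * W x) * indicator {-1..1} x"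
      using AE_lborel_singleton[of "-1::real"] AE_lborel_singleton[of "1::real"]
    proof eventually_elim
      case (elim x)
      then show ?case by (cases "x \<in> {-1..1}") (auto simp: W_tau_eq power_divide)
    qed
  qed
  define \<Phi> where "\<Phi> x = F x / \<tau> x" for x
  have [measurable]: "\<Phi> \<in> borel_measurable borel" unfolding \<Phi>_def by measurable
  have fin: "(\<integral>\<^sup>+ x \<in> {-1..1}. ennreal ((\<Phi> x)\<^sup>2 * W x) \<partial>lborel) < \<infinity>"
    using F unfolding in_L2W_def norm_eq \<Phi>_def by simp
  have e4: "\<epsilon> / 4 > 0" using \<epsilon> by simp
  obtain h where h: "continuous_on UNIV h"
    and hI: "(\<integral>\<^sup>+ x \<in> {-1..1}. ennreal ((\<Phi> x - h x)\<^sup>2 * W x) \<partial>lborel) < ennreal (\<epsilon> / 4)"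
    by (rule continuous_dense_L2[OF _ _ fin gegW_bounds e4]) auto
  have [measurable]: "h \<in> borel_measurable borel" by (rule borel_measurable_continuous_onI[OF h])
  have h': "continuous_on {-1..1} h" by (rule continuous_on_subset[OF h]) simp
  \<comment> \<open>The square is \<epsilon>/16; over length 2 this gives \<epsilon>/8, less than
    the quarter available.\<close>
  define \<eta> where "\<eta> = sqrt \<epsilon> / 4"
  have \<eta>: "\<eta> > 0" using \<epsilon> by (simp add: \<eta>_def)
  obtain N c where Nc: "\<And>z. z \<in> {-1..1} \<Longrightarrow> \<bar>h z - (\<Sum>i<N. c i * f i z)\<bar> \<le> \<eta>"
    using f_approximates_continuous[OF nz h' \<eta>] by blast
  define s where "s x = (\<Sum>i<N. c i * poly (gegP i) x) / \<tau> x" for x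
  have s: "s x = (\<Sum>i<N. c i * f i x)" for x
    by (simp add: s_def f_def sum_divide_distrib)
  have [measurable]: "s \<in> borel_measurable borel" unfolding s_def by measurable
  have "(\<integral>\<^sup>+ x \<in> {-1..1}. ennreal ((h x - s x)\<^sup>2 * W x) \<partial>lborel)
      \<le> (\<integral>\<^sup>+ x. ennreal (\<epsilon> / 16) * indicator {-1..1} (x::real) \<partial>lborel)"
  proof (rule nn_integral_mono)
    fix x :: real
    show "ennreal ((h x - s x)\<^sup>2 * W x) * indicator {-1..1} x \<le> ennreal (\<epsilon> / 16) * indicator {-1..1} x"
    proof (cases "x \<in> {-1..1}")
      case True
      have "(h x - s x)\<^sup>2 \<le> \<eta>\<^sup>2" using Nc[OF True] \<eta> by (simp add: s abs_le_square_iff[symmetric])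
      then have "(h x - s x)\<^sup>2 * W x \<le> \<eta>\<^sup>2 * 1"
        using gegW_bounds[OF True, of k] by (intro mult_mono) auto
      also have "\<dots> = \<epsilon> / 16" using \<epsilon> by (simp add: \<eta>_def power_divide)
      finally show ?thesis using True by (simp add: ennreal_leI)
    qed simp
  qed
  also have "\<dots> = ennreal (\<epsilon> / 16) * ennreal 2"
    by (subst nn_integral_cmult_indicator) auto
  also have "\<dots> = ennreal (\<epsilon> / 16 * 2)" using \<epsilon> by (intro ennreal_mult[symmetric]) auto
  also have "\<dots> < ennreal (\<epsilon> / 4)" using \<epsilon> by (intro ennreal_lessI) auto
  finally have sI: "(\<integral>\<^sup>+ x \<in> {-1..1}. ennreal ((h x - s x)\<^sup>2 * W x) \<partial>lborel) < ennreal (\<epsilon> / 4)" .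
  have "(\<integral>\<^sup>+ x \<in> {-1..1}. ennreal ((F x - (\<Sum>i<N. c i * poly (gegP i) x))\<^sup>2 * W_tau (alph k) tauP x) \<partial>lborel)
      = (\<integral>\<^sup>+ x \<in> {-1..1}. ennreal ((\<Phi> x - s x)\<^sup>2 * W x) \<partial>lborel)"
    unfolding norm_eq \<Phi>_def s_def by (simp add: diff_divide_distrib)
  also have "\<dots> \<le> 2 * (\<integral>\<^sup>+ x \<in> {-1..1}. ennreal ((\<Phi> x - h x)\<^sup>2 * W x) \<partial>lborel)
       + 2 * (\<integral>\<^sup>+ x \<in> {-1..1}. ennreal ((h x - s x)\<^sup>2 * W x) \<partial>lborel)"
    by (rule nn_integral_square_triangle) (use gegW_bounds in auto)
  also have "\<dots> < ennreal (4 * (\<epsilon> / 4))"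
    using \<epsilon> by (intro two_ennreal_less hI sI) auto
  finally have "(\<integral>\<^sup>+ x \<in> {-1..1}. ennreal ((F x - (\<Sum>i<N. c i * poly (gegP i) x))\<^sup>2 * W_tau (alph k) tauP x) \<partial>lborel) < ennreal \<epsilon>"
    by simp
  then show "\<exists>N c. (\<integral>\<^sup>+ x \<in> {-1..1}. ennreal ((F x - (\<Sum>i<N. c i * poly (gegP i) x))\<^sup>2 * W_tau (alph k) tauP x) \<partial>lborel) < ennreal \<epsilon>"
    by blast
qed

section \<open>Degrees and the eigenpolynomial family\<close>

lemma eigenfamily_gegP:
  assumes nz: "\<And>z. z \<in> {-1..1} \<Longrightarrow> \<tau> z \<noteq> 0"
  shows "exc_geg_eigenfamily (alph k) tauP gegP"
proof -
  have T0: "tauP \<noteq> 0" using nz[of 0] by (metis atLeastAtMost_iff poly_0 poly_tauP neg_le_0_iff_le zero_le_one)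
  have P0: "gegP i \<noteq> 0" for i
  proof
    assume 0: "gegP i = 0"
    obtain N where N: "((\<lambda>u. W u * (f i u)\<^sup>2) has_integral N) {-1..1}"
      "N * (1 + (if i \<in> set m then 1 else 0) * t i * \<nu> i) = \<nu> i"
      using f_norm[OF nz] by blast
    have "f i u = 0" for u using poly_gegP[of i u] 0 by (simp add: f_def)
    then have "N = 0" using N(1) by simp
    then show False using N(2) geg_nu_pos[of k i] by simp
  qed
  have eig: "(real (degree (gegP i)) - real (degree tauP))
      * (real (degree (gegP i)) - real (degree tauP) + 2 * alph k) = ev i" for i
    using T_op_eigenvalue_degree[OF T0 P0, where ev = "- ev i"] T_op_gegP by simp
  \<comment> \<open>The eigenvalue leaves two candidates, i and -i - 2 \<alpha>, for the degree of
    \<open>gegP i\<close> minus that of \<open>tauP\<close>. Once i is at least the degree of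
    \<open>tauP\<close>, the second would make the degree of \<open>gegP i\<close> negative.\<close>
  have deg: "degree (gegP i) = degree tauP + i" if "i \<ge> degree tauP" for i
  proof -
    let ?e = "real (degree (gegP i)) - real (degree tauP)"
    have "(?e - real i) * (?e + real i + 2 * alph k) = 0"
      using eig[of i] by (simp add: algebra_simps)
    moreover have "?e + real i + 2 * alph k > 0"
      using that by (intro add_nonneg_pos) auto
    ultimately have "?e = real i" by auto
    then show ?thesis by linarith
  qed
  have "inj (\<lambda>i. degree (gegP i))"
  proof (rule injI)
    fix i j assume "degree (gegP i) = degree (gegP j)"
    then have "ev i = ev j" using eig[of i] eig[of j] by simp
    then show "i = j" using geg_eigenvalue_inj[of i k j] by simp
  qed
  moreover have "finite (UNIV - range (\<lambda>i. degree (gegP i)))"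
  proof (rule finite_subset)
    \<comment> \<open>The index for a degree d is d minus the degree of \<open>tauP\<close>; the
      factor 2 ensures that this index is large enough for \<open>deg\<close>.\<close>
    show "UNIV - range (\<lambda>i. degree (gegP i)) \<subseteq> {..<2 * degree tauP}"
    proof
      fix d assume d: "d \<in> UNIV - range (\<lambda>i. degree (gegP i))"
      show "d \<in> {..<2 * degree tauP}"
      proof (rule ccontr)
        assume "d \<notin> {..<2 * degree tauP}"
        then have "degree (gegP (d - degree tauP)) = d" by (subst deg) auto
        then show False using d by (metis Diff_iff rangeI)
      qed
    qed
  qed simp
  moreover have "is_eigenpoly (alph k) tauP (gegP i)" for i
    unfolding is_eigenpoly_def using P0 T_op_gegP by (intro conjI exI[of _ "- ev i"]) auto
  ultimately show ?thesis using T0 by (simp add: exc_geg_eigenfamily_def)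
qed

lemma gegCm_norm:
  assumes nz: "\<And>z. z \<in> {-1..1} \<Longrightarrow> \<tau> z \<noteq> 0"
  shows "((\<lambda>u. (gegCm k m (map t m) i u)\<^sup>2 * W_tau (alph k) tauP u) has_integral
     (\<nu> i / (1 + (if i \<in> set m then 1 else 0) * t i * \<nu> i))) {-1..1}"
proof -
  obtain N where N: "((\<lambda>u. W u * (f i u)\<^sup>2) has_integral N) {-1..1}"
      "N * (1 + (if i \<in> set m then 1 else 0) * t i * \<nu> i) = \<nu> i"
    using f_norm[OF nz] by blast
  have "1 + (if i \<in> set m then 1 else 0) * t i * \<nu> i \<noteq> 0"
    using N(2) geg_nu_pos[of k i] by auto
  then have "N = \<nu> i / (1 + (if i \<in> set m then 1 else 0) * t i * \<nu> i)"
    using N(2) nonzero_eq_divide_eq by blast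
  moreover have "((\<lambda>u. (gegCm k m (map t m) i u)\<^sup>2 * W_tau (alph k) tauP u) has_integral N) {-1..1}"
    by (rule has_integral_spike_finite[OF _ _ N(1), of "{-1, 1}"])
       (auto simp: W_tau_eq f_def power_divide)
  ultimately show ?thesis by simp
qed

end

theorem mainTheorem17:
  fixes k :: nat and m :: "nat list" and t :: "nat \<Rightarrow> real"
  assumes "distinct m"
  shows "((\<forall>z\<in>{-1..1}. tau_m k m (map t m) z \<noteq> 0) \<longleftrightarrow>
            (\<forall>j\<in>set m. t j > - inverse (geg_nu (alph k) j)))
       \<and> ((\<forall>j\<in>set m. t j > - inverse (geg_nu (alph k) j)) \<longrightarrow>
            (\<exists>\<tau> pis. (\<forall>z. poly \<tau> z = tau_m k m (map t m) z) \<and>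
               (\<forall>i z. poly (pis i) z = gegCm k m (map t m) i z) \<and>
               exc_geg_family (alph k) \<tau> pis \<and>
               (\<forall>i. ((\<lambda>u. (gegCm k m (map t m) i u)^2 * W_tau (alph k) \<tau> u)
                     has_integral
                     (geg_nu (alph k) i /
                        (1 + (if i \<in> set m then 1 else 0) * t i * geg_nu (alph k) i)))
                    {-1..1})))"
proof -
  interpret geg_transform k m t by unfold_locales (rule assms)
  have iff: "(\<forall>z\<in>{-1..1}. \<tau> z \<noteq> 0) \<longleftrightarrow> (\<forall>j\<in>set m. t j > - inverse (\<nu> j))"
    using nonvanishing_imp_parameters parameters_imp_nonvanishing by blast
  have "exc_geg_family (alph k) tauP gegP" if "\<forall>z\<in>{-1..1}. \<tau> z \<noteq> 0"
  proof -
    have nz: "\<And>z. z \<in> {-1..1} \<Longrightarrow> \<tau> z \<noteq> 0" using that by blast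
    show ?thesis
      unfolding exc_geg_family_def exc_geg_operator_def
      using nz eigenfamily_gegP[OF nz] complete_gegP[OF nz] by auto
  qed
  then show ?thesis using iff gegCm_norm
    by (intro conjI impI exI[of _ tauP] exI[of _ gegP]) auto
qed

end
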